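(* Let $\mathfrak B$ be a Banach space, $A\in C(\mathbb R,[\mathfrak B])$, $f\in C(\mathbb R,\mathfrak B)$ and $F\in C(\mathbb R\times\mathfrak B,\mathfrak B)$ with $F(t,0)=0$ for all $t\in\mathbb R$. Assume: 1) the equation $x'=A(t)x$ is hyperbolic on $\mathbb R$ (has an exponential dichotomy on $\mathbb R$) with projection $P$; 2) (Condition (C)) the family $\{U(t,A)PU^{-1}(t,A)\}_{t\in\mathbb R}$ is precompact in $[\mathfrak B]$; 3) the functions $A$, $f$ and $F$ are Lagrange stable; 4) $F$ is Lipschitzian in the second variable: $|F(t,u_1)-F(t,u_2)|\le L|u_1-u_2|$ for all $t\in\mathbb R$, $u_1,u_2\in\mathfrak B$, with a constant $L>0$. Then there exists $\varepsilon_0>0$ such that: (i) for every $|\varepsilon|\le\varepsilon_0$ the equation $\frac{dx}{dt}=A(t)x+f(t)+\varepsilon F(t,x)$ has a remotely compatible solution $\varphi_\varepsilon\in C_b(\mathbb R,\mathfrak B)$; (ii) the solution $\varphi_\varepsilon$ satisfies $\varphi_\varepsilon(t)=\int_{-\infty}^{+\infty}G_A(t,\tau)\bigl[f(\tau)+\varepsilon F(\tau,\varphi_\varepsilon(\tau))\bigr]\,d\tau$ for $t\in\mathbb R$; (iii) $\varphi_\varepsilon\to\varphi_0$ as $\varepsilon\to0$ uniformly with respect to $t\in\mathbb R$, where $\varphi_0\in C_b(\mathbb R,\mathfrak B)$ is the remotely compatible solution of $x'=A(t)x+f(t)$ given by $\varphi_0(t)=\int_{-\infty}^{+\infty}G_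A(t,\tau)f(\tau)\,d\tau$.
   Context: $\mathfrak B$ is a real or complex Banach space with norm $|\cdot|$; $[\mathfrak B]$ is the Banach space of bounded linear operators on $\mathfrak B$ with the operator norm; $C_b(\mathbb R,\mathfrak B)$ is the space of bounded continuous functions $\mathbb R\to\mathfrak B$. For a metric space $E$, $C(\mathbb R,E)$ carries the topology of uniform convergence on compact sets; $C(\mathbb R\times\mathfrak B,\mathfrak B)$ and, for compact $K\subset\mathfrak B$, $C(\mathbb R\times K,\mathfrak B)$ carry the compact-open topology; $g^h(t):=g(t+h)$ and $F^h(t,x):=F(t+h,x)$. A function $g$ in one of these spaces is Lagrange stable if the set of its translates $\{g^h:h\in\mathbb R\}$ is precompact in that space. $U(t,A)$ denotes the Cauchy operator of $x'=A(t)x$ (so $U(0,A)=I$ and $t\mapsto U(t,A)x$ is the solution with value $x$ at $t=0$). The equation is hyperbolic (has an exponential dichotomy) on $\mathbb R$ with projection $P$ if $P\in[\mathfrak B]$, $P^2=P$, and there are constants $\mathcal N\ge1$, $\nu>0$ with $\|U(t,A)PU^{-1}(\tau,A)\|\le\mathcal N e^{-\nu(t-\tau)}$ for $t>\tau$ and $\|U(t,A)(I-P)U^{-1}(\tau,A)\|\le\mathcal N e^{\nu(t-\tau)}$ for $t<\tau$ ($t,\tau\in\mathbb R$). Its Green function is $G_A(t,\tau)=U(t,A)PU^{-1}(\tau,A)$ for $t>\tau$ and $G_A(t,\tau)=-U(t,A)(I-P)U^{-1}(\tau,A)$ for $t<\tau$. For a function $g$ in one of the function spaces above (or a tuple of such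 functions), $\mathfrak L_g$ is the set of all real sequences $\{t_n\}$ with $t_n\to+\infty$ or $t_n\to-\infty$ such that the translates $g^{t_n}$ converge in the corresponding space. A solution $\varphi$ on $\mathbb R$ of $x'=A(t)x+f(t)+H(t,x)$ is remotely compatible if $K:=\overline{\varphi(\mathbb R)}$ is compact and $\mathfrak L_{(A,f,H_K)}\subseteq\mathfrak L_\varphi$, where $H_K:=H|_{\mathbb R\times K}$ (for $H=0$ the condition reads $\mathfrak L_{(A,f)}\subseteq\mathfrak L_\varphi$). *)

theory Defs
  imports "HOL-Analysis.Analysis"
begin

section \<open>The phase space and its operators\<close>

text \<open>
  A real normed space whose scalar multiplication extends to a field \<open>'k\<close>. By the Gelfand--Mazur
  theorem every type of class \<open>real_normed_field\<close> is isomorphic to the reals or to the complex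
  numbers, so for \<open>'a :: banach\<close> these are exactly the real and the complex Banach spaces.
\<close>

locale normed_space_over = vector_space smul
  for smul :: "'k::real_normed_field \<Rightarrow> 'a::real_normed_vector \<Rightarrow> 'a" +
  assumes norm_smul: "norm (smul c x) = norm c * norm x"
    and smul_of_real: "smul (of_real r) x = r *\<^sub>R x"

definition operators_over :: "('k \<Rightarrow> 'a::real_normed_vector \<Rightarrow> 'a) \<Rightarrow> ('a \<Rightarrow>\<^sub>L 'a) set" where
  "operators_over smul = {T. \<forall>c x. blinfun_apply T (smul c x) = smul c (blinfun_apply T x)}"

definition blinfun_inv :: "('a::real_normed_vector \<Rightarrow>\<^sub>L 'a) \<Rightarrow> 'a \<Rightarrow>\<^sub>L 'a" where
  "blinfun_inv T = (THE S. S o\<^sub>L T = id_blinfun \<and> T o\<^sub>L S = id_blinfun)"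

section \<open>Linear equations, dichotomy and the Green function\<close>

definition cauchy_op :: "(real \<Rightarrow> 'a::real_normed_vector \<Rightarrow>\<^sub>L 'a) \<Rightarrow> real \<Rightarrow> 'a \<Rightarrow>\<^sub>L 'a" where
  "cauchy_op A = (THE U. U 0 = id_blinfun \<and>
     (\<forall>x t. ((\<lambda>s. U s x) has_vector_derivative A t (U t x)) (at t)))"

definition exp_dichotomy ::
  "(real \<Rightarrow> 'a::real_normed_vector \<Rightarrow>\<^sub>L 'a) \<Rightarrow> ('a \<Rightarrow>\<^sub>L 'a) \<Rightarrow> bool" where
  "exp_dichotomy A P \<longleftrightarrow> P o\<^sub>L P = P \<and>
     (\<exists>N \<nu>. N \<ge> 1 \<and> \<nu> > 0 \<and>
        (\<forall>t \<tau>. t > \<tau> \<longrightarrow>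
           norm (cauchy_op A t o\<^sub>L P o\<^sub>L blinfun_inv (cauchy_op A \<tau>)) \<le> N * exp (- \<nu> * (t - \<tau>))) \<and>
        (\<forall>t \<tau>. t < \<tau> \<longrightarrow>
           norm (cauchy_op A t o\<^sub>L (id_blinfun - P) o\<^sub>L blinfun_inv (cauchy_op A \<tau>))
             \<le> N * exp (\<nu> * (t - \<tau>))))"

text \<open>
  The Green function is not defined on the diagonal; the value \<open>0\<close> there is arbitrary and does not
  affect any integral in \<open>\<tau>\<close>.
\<close>

definition green ::
  "(real \<Rightarrow> 'a::real_normed_vector \<Rightarrow>\<^sub>L 'a) \<Rightarrow> ('a \<Rightarrow>\<^sub>L 'a) \<Rightarrow> real \<Rightarrow> real \<Rightarrow> 'a \<Rightarrow>\<^sub>L 'a" where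
  "green A P t \<tau> =
     (if t > \<tau> then cauchy_op A t o\<^sub>L P o\<^sub>L blinfun_inv (cauchy_op A \<tau>)
      else if t < \<tau> then - (cauchy_op A t o\<^sub>L (id_blinfun - P) o\<^sub>L blinfun_inv (cauchy_op A \<tau>))
      else 0)"

section \<open>Spaces of continuous functions\<close>

text \<open>
  The set \<open>C(S, E)\<close>, for a subset \<open>S\<close> of a type; its elements are made \<open>undefined\<close> outside \<open>S\<close>, so
  that functions agreeing on \<open>S\<close> are equal. The compact-open topology on it is, for metric \<open>E\<close>, the
  topology of uniform convergence on compact sets (see \<open>limitin_compact_open\<close> below).
\<close>

definition cont_funs :: "'s::topological_space set \<Rightarrow> ('s \<Rightarrow> 'e::topological_space) set" where
  "cont_funs S = {g \<in> extensional S. continuous_on S g}"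

definition compact_open ::
  "'s::topological_space set \<Rightarrow> ('s \<Rightarrow> 'e::topological_space) topology" where
  "compact_open S = topology_generated_by
     {{g \<in> cont_funs S. g ` K \<subseteq> U} | K U. compact K \<and> K \<subseteq> S \<and> open U}"

definition precompact_in :: "'x topology \<Rightarrow> 'x set \<Rightarrow> bool" where
  "precompact_in X S \<longleftrightarrow> S \<subseteq> topspace X \<and> compactin X (X closure_of S)"

definition shift :: "real \<Rightarrow> (real \<Rightarrow> 'e) \<Rightarrow> real \<Rightarrow> 'e" where
  "shift h g = (\<lambda>t. g (t + h))"

definition shift2 :: "real \<Rightarrow> (real \<times> 'b \<Rightarrow> 'e) \<Rightarrow> real \<times> 'b \<Rightarrow> 'e" where
  "shift2 h F = (\<lambda>(t, x). F (t + h, x))"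

text \<open>
  In the following two definitions \<open>X\<close> is a function space and \<open>T h\<close> is the translate by \<open>h\<close> of the
  function (or tuple of functions, with \<open>X\<close> a product space) under consideration.
\<close>

definition lagrange_stable :: "'x topology \<Rightarrow> (real \<Rightarrow> 'x) \<Rightarrow> bool" where
  "lagrange_stable X T \<longleftrightarrow> precompact_in X (range T)"

definition translate_seqs :: "'x topology \<Rightarrow> (real \<Rightarrow> 'x) \<Rightarrow> (nat \<Rightarrow> real) set" where
  "translate_seqs X T =
     {s. (filterlim s at_top sequentially \<or> filterlim s at_bot sequentially) \<and>
         (\<exists>l. limitin X (\<lambda>n. T (s n)) l sequentially)}"

section \<open>Remotely compatible solutions\<close>

definition is_solution ::
  "(real \<Rightarrow> 'a::real_normed_vector \<Rightarrow>\<^sub>L 'a) \<Rightarrow> (real \<Rightarrow> 'a) \<Rightarrow> (real \<times> 'a \<Rightarrow> 'a) \<Rightarrow> (real \<Rightarrow> 'a) \<Rightarrow> bool"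
  where "is_solution A f H \<phi> \<longleftrightarrow>
     (\<forall>t. (\<phi> has_vector_derivative (A t (\<phi> t) + f t + H (t, \<phi> t))) (at t))"

definition remotely_compatible ::
  "(real \<Rightarrow> 'a::real_normed_vector \<Rightarrow>\<^sub>L 'a) \<Rightarrow> (real \<Rightarrow> 'a) \<Rightarrow> (real \<times> 'a \<Rightarrow> 'a) \<Rightarrow> (real \<Rightarrow> 'a) \<Rightarrow> bool"
  where "remotely_compatible A f H \<phi> \<longleftrightarrow> is_solution A f H \<phi> \<and>
     (let K = closure (range \<phi>); H\<^sub>K = restrict H (UNIV \<times> K) in
        compact K \<and>
        translate_seqs
          (prod_topology (compact_open UNIV)
            (prod_topology (compact_open UNIV) (compact_open (UNIV \<times> K))))
          (\<lambda>h. (shift h A, shift h f, shift2 h H\<^sub>K))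
        \<subseteq> translate_seqs (compact_open UNIV) (\<lambda>h. shift h \<phi>))"

section \<open>Basic facts\<close>

lemma topspace_compact_open [simp]: "topspace (compact_open S) = cont_funs S"
proof -
  have "cont_funs S \<in> {{g \<in> cont_funs S. g ` K \<subseteq> U} | K U. compact K \<and> K \<subseteq> S \<and> open U}"
    by (rule CollectI, rule exI[of _ "{}"], rule exI[of _ UNIV]) auto
  then show ?thesis
    unfolding compact_open_def topology_generated_by_topspace by blast
qed

lemma limitin_topology_generated_by:
  assumes l: "l \<in> \<Union>B"
    and ev: "\<And>W. W \<in> B \<Longrightarrow> l \<in> W \<Longrightarrow> \<forall>\<^sub>F i in F. h i \<in> W"
  shows "limitin (topology_generated_by B) h l F"
  unfolding limitin_def
proof (intro conjI allI impI)
  show "l \<in> topspace (topology_generated_by B)" using l by simp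
  fix W assume W: "openin (topology_generated_by B) W \<and> l \<in> W"
  then have "generate_topology_on B W" by (simp add: openin_topology_generated_by_iff)
  then have "l \<in> W \<longrightarrow> (\<forall>\<^sub>F i in F. h i \<in> W)"
  proof induction
    case (Int a b)
    then show ?case by (auto intro: eventually_conj)
  next
    case (UN K)
    show ?case
    proof
      assume "l \<in> \<Union>K"
      then obtain k where k: "k \<in> K" "l \<in> k" by blast
      then have "\<forall>\<^sub>F i in F. h i \<in> k" using UN by blast
      then show "\<forall>\<^sub>F i in F. h i \<in> \<Union>K" by (rule eventually_mono) (use k in blast)
    qed
  qed (use ev in auto)
  with W show "\<forall>\<^sub>F i in F. h i \<in> W" by blast
qed

lemma limitin_compact_open:
  fixes l :: "'s::t2_space \<Rightarrow> 'e::metric_space"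
  shows "limitin (compact_open S) h l F \<longleftrightarrow>
    l \<in> cont_funs S \<and> (\<forall>\<^sub>F i in F. h i \<in> cont_funs S) \<and>
    (\<forall>K. compact K \<and> K \<subseteq> S \<longrightarrow> uniform_limit K h l F)" (is "?lhs \<longleftrightarrow> ?rhs")
proof
  assume L: ?lhs
  have lC: "l \<in> cont_funs S" using L limitin_topspace by fastforce
  have hC: "\<forall>\<^sub>F i in F. h i \<in> cont_funs S"
    using L lC openin_topspace[of "compact_open S"] unfolding limitin_def topspace_compact_open
    by blast
  have "uniform_limit K h l F" if K: "compact K" "K \<subseteq> S" for K
  proof (rule uniform_limitI)
    fix e :: real assume e: "e > 0"
    have cl: "continuous_on K l"
      using lC K continuous_on_subset unfolding cont_funs_def by blast
    have "compact (l ` K)" by (rule compact_continuous_image[OF cl K(1)])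
    moreover have "l ` K \<subseteq> (\<Union>x\<in>K. ball (l x) (e/3))" using e by auto
    ultimately obtain D where D: "D \<subseteq> K" "finite D" "l ` K \<subseteq> (\<Union>x\<in>D. ball (l x) (e/3))"
      using compactE_image[of "l ` K" K "\<lambda>x. ball (l x) (e/3)"] by (metis open_ball)
    have "\<forall>\<^sub>F i in F. h i ` (K \<inter> l -` cball (l x) (e/3)) \<subseteq> ball (l x) (e/2)" for x
    proof -
      let ?K = "K \<inter> l -` cball (l x) (e/3)"
      let ?W = "{g \<in> cont_funs S. g ` ?K \<subseteq> ball (l x) (e/2)}"
      have "closed ?K"
        by (rule continuous_closed_preimage[OF cl compact_imp_closed[OF K(1)] closed_cball])
      then have "compact ?K"
        using compact_Int_closed[OF K(1), of ?K] by simp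
      then have "openin (compact_open S) ?W"
        using K unfolding compact_open_def
        by (intro topology_generated_by_Basis CollectI exI[of _ ?K] exI[of _ "ball (l x) (e/2)"]) auto
      moreover have "l \<in> ?W" using lC e by auto
      ultimately have "\<forall>\<^sub>F i in F. h i \<in> ?W" using L unfolding limitin_def by blast
      then show ?thesis by (rule eventually_mono) auto
    qed
    then have "\<forall>\<^sub>F i in F. \<forall>x\<in>D. h i ` (K \<inter> l -` cball (l x) (e/3)) \<subseteq> ball (l x) (e/2)"
      using D(2) by (simp add: eventually_ball_finite)
    then show "\<forall>\<^sub>F i in F. \<forall>y\<in>K. dist (h i y) (l y) < e"
    proof (rule eventually_mono, intro ballI)
      fix i y
      assume i: "\<forall>x\<in>D. h i ` (K \<inter> l -` cball (l x) (e/3)) \<subseteq> ball (l x) (e/2)" and y: "y \<in> K"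
      obtain x where x: "x \<in> D" "dist (l x) (l y) < e/3" using D(3) y by fastforce
      then have "dist (l x) (h i y) < e/2" using i y by fastforce
      with x(2) e show "dist (h i y) (l y) < e"
        using dist_triangle[of "h i y" "l y" "l x"] by (simp add: dist_commute)
    qed
  qed
  with lC hC show ?rhs by blast
next
  assume R: ?rhs
  show ?lhs
    unfolding compact_open_def
  proof (rule limitin_topology_generated_by)
    show "l \<in> \<Union>{{g \<in> cont_funs S. g ` K \<subseteq> U} | K U. compact K \<and> K \<subseteq> S \<and> open U}"
      using conjunct1[OF R, folded topspace_compact_open]
      unfolding compact_open_def topology_generated_by_topspace .
  next
    fix W assume "W \<in> {{g \<in> cont_funs S. g ` K \<subseteq> U} | K U. compact K \<and> K \<subseteq> S \<and> open U}"
      and lW: "l \<in> W"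
    then obtain K U where W: "W = {g \<in> cont_funs S. g ` K \<subseteq> U}"
      and K: "compact K" "K \<subseteq> S" "open U" by blast
    have "continuous_on K l"
      using R K continuous_on_subset unfolding cont_funs_def by blast
    then have "compact (l ` K)" using K(1) by (rule compact_continuous_image)
    moreover have "l ` K \<subseteq> U" using lW W by blast
    ultimately obtain e where e: "e > 0" "(\<Union>x\<in>l ` K. ball x e) \<subseteq> U"
      using compact_subset_open_imp_ball_epsilon_subset K(3) by metis
    have "uniform_limit K h l F" using R K by blast
    then have "\<forall>\<^sub>F i in F. \<forall>y\<in>K. dist (h i y) (l y) < e" using e(1) by (rule uniform_limitD)
    moreover have "\<forall>\<^sub>F i in F. h i \<in> cont_funs S" using R by blast
    ultimately show "\<forall>\<^sub>F i in F. h i \<in> W"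
    proof eventually_elim
      case (elim i)
      have "h i y \<in> U" if "y \<in> K" for y
      proof -
        have "h i y \<in> ball (l y) e" using elim(1) that by (simp add: dist_commute)
        then show ?thesis using e(2) that by blast
      qed
      then show ?case using elim(2) W by blast
    qed
  qed
qed

lemma shift2_restrict: "shift2 h (restrict H (UNIV \<times> K)) = restrict (shift2 h H) (UNIV \<times> K)"
  by (auto simp: shift2_def restrict_def fun_eq_iff)

lemma remotely_compatible_linear:
  "remotely_compatible A f (\<lambda>_. 0) \<phi> \<longleftrightarrow>
     is_solution A f (\<lambda>_. 0) \<phi> \<and> compact (closure (range \<phi>)) \<and>
     translate_seqs (prod_topology (compact_open UNIV) (compact_open UNIV))
       (\<lambda>h. (shift h A, shift h f))
     \<subseteq> translate_seqs (compact_open UNIV) (\<lambda>h. shift h \<phi>)"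
proof -
  let ?K = "closure (range \<phi>)"
  let ?z = "restrict (\<lambda>_::real \<times> 'a. 0::'a) (UNIV \<times> ?K)"
  have z: "shift2 h ?z = ?z" for h
    by (auto simp: shift2_def restrict_def fun_eq_iff)
  have "continuous_on (UNIV \<times> ?K) ?z"
    by (subst continuous_on_cong[OF refl, of _ _ "\<lambda>_. 0"]) auto
  then have zC: "?z \<in> cont_funs (UNIV \<times> ?K)" unfolding cont_funs_def by simp
  have lim: "(\<exists>l. limitin (prod_topology X (prod_topology Y (compact_open (UNIV \<times> ?K))))
                 (\<lambda>n. (a n, b n, ?z)) l sequentially) \<longleftrightarrow>
             (\<exists>l. limitin (prod_topology X Y) (\<lambda>n. (a n, b n)) l sequentially)"
    for X :: "(real \<Rightarrow> 'a \<Rightarrow>\<^sub>L 'a) topology" and Y :: "(real \<Rightarrow> 'a) topology" and a b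
    using zC by (simp add: limitin_pairwise o_def split_paired_Ex) (auto intro!: exI[of _ ?z])
  have "translate_seqs
          (prod_topology (compact_open UNIV)
            (prod_topology (compact_open UNIV) (compact_open (UNIV \<times> ?K))))
          (\<lambda>h. (shift h A, shift h f, shift2 h ?z)) =
        translate_seqs (prod_topology (compact_open UNIV) (compact_open UNIV))
          (\<lambda>h. (shift h A, shift h f))"
    unfolding translate_seqs_def z lim ..
  then show ?thesis unfolding remotely_compatible_def Let_def by simp
qed

end

theory Submission
  imports Defs
begin

text \<open>
  Fix the weight \<open>exp (- \<nu> \<bar>t - h\<bar> / 2)\<close>, where \<open>\<nu>\<close> is the dichotomy exponent. Integrating
  \<open>w' = A w + g\<close> against the Green function bounds the weighted supremum of a bounded solution \<open>w\<close> by
  that of \<open>g\<close>, uniformly in \<open>h\<close>. The difference of two translates of a bounded solution \<open>\<phi>\<close> of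
  the semilinear equation solves such an equation; its forcing is, up to a small Lipschitz term, the
  difference of the translates of \<open>A\<close>, \<open>f\<close> and the nonlinearity on \<open>closure (range \<phi>)\<close>. Hence
  translates of \<open>\<phi>\<close> are close on compact sets whenever those of the data are: this gives remote
  compatibility along sequences, and it shows that the integral operator preserves the closed set of
  bounded functions with precompact translates, in which the contraction principle then yields \<open>\<phi>\<close>.
\<close>

section \<open>Linear differential equations in Banach spaces\<close>

text \<open>In an infinite-dimensional space a bounded range need not be precompact, so a fixed
  point among all bounded functions would not yet be remotely compatible; moreover, translates of
  the nonlinearity are controlled only on compact sets of states. Functions with precompact
  translates meet both difficulties, since their ranges have compact closure. Two translates are
  compared in the original time: the shift of \<open>\<phi>\<close> by \<open>k - h\<close> is
  subtracted from \<open>\<phi>\<close>, so the same operator \<open>A s\<close> and the same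
  dichotomy serve every pair, and only the centre \<open>h\<close> of the weight moves. The rate
  \<open>\<nu> / 2\<close> splits the decay of the Green function: one half pays for moving the
  weight from one time to another, the other half keeps the kernel integrable with total mass
  \<open>\<kappa>\<close>. Smallness enters only as \<open>\<kappa> * l \<le> 1/4\<close>, with
  \<open>l\<close> the Lipschitz constant of the perturbation; it serves both the contraction and
  the absorption of the Lipschitz term.\<close>

lemma has_vector_derivative_reflect:
  fixes D :: "real \<Rightarrow> 'a::real_normed_vector"
  assumes "(D has_vector_derivative D') (at (- s))"
  shows "((\<lambda>s. D (- s)) has_vector_derivative - D') (at s)"
proof -
  have "(uminus has_vector_derivative (- 1 :: real)) (at s)"
    by (auto intro!: derivative_eq_intros)
  from vector_diff_chain_at[OF this, of D D'] assms show ?thesis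
    by (simp add: o_def)
qed

lemma has_vector_derivative_translate:
  fixes D :: "real \<Rightarrow> 'a::real_normed_vector"
  assumes "(D has_vector_derivative D') (at (s + h))"
  shows "((\<lambda>s. D (s + h)) has_vector_derivative D') (at s)"
proof -
  have "((\<lambda>s. s + h) has_vector_derivative (1 :: real)) (at s)"
    by (auto intro!: derivative_eq_intros)
  from vector_diff_chain_at[OF this, of D D'] assms show ?thesis
    by (simp add: o_def)
qed

lemma continuous_on_UNIV_has_vector_derivative:
  fixes D :: "real \<Rightarrow> 'a::real_normed_vector"
  assumes "\<And>s. (D has_vector_derivative D' s) (at s)"
  shows "continuous_on S D"
  using has_vector_derivative_continuous[OF assms]
  by (simp add: continuous_at_imp_continuous_on)

text \<open>The oriented integral from 0 to \<open>t\<close>: an interval with reversed endpoints is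
  empty and contributes 0, so at least one of the two terms vanishes.\<close>

definition primitive :: "(real \<Rightarrow> 'a::real_normed_vector) \<Rightarrow> real \<Rightarrow> 'a" where
  "primitive g t = integral {0..t} g - integral {t..0} g"

lemma primitive_0 [simp]: "primitive g 0 = 0"
  by (simp add: primitive_def)

lemma has_vector_derivative_primitive:
  fixes g :: "real \<Rightarrow> 'a::banach"
  assumes g: "continuous_on UNIV g"
  shows "(primitive g has_vector_derivative g t) (at t)"
proof -
  \<comment> \<open>Moving the base point from 0 to \<open>- n\<close> covers both signs of
    \<open>s\<close> by one ordinary integral; the extra 1 makes \<open>t\<close> an interior
    point.\<close>
  define n where "n = \<bar>t\<bar> + 1"
  have int: "g integrable_on {a..b}" for a b
    by (intro integrable_continuous_interval continuous_on_subset[OF g]) auto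
  have eq: "primitive g s = integral {-n..s} g - integral {-n..0} g" if "s \<in> {-n<..<n}" for s
  proof (cases "s \<ge> 0")
    case True
    have "integral {-n..0} g + integral {0..s} g = integral {-n..s} g"
      using True by (intro Henstock_Kurzweil_Integration.integral_combine int) (auto simp: n_def)
    moreover have "integral {s..0} g = 0" using True by (cases "s = 0") auto
    ultimately show ?thesis by (simp add: primitive_def algebra_simps)
  next
    case False
    have "integral {-n..s} g + integral {s..0} g = integral {-n..0} g"
      using False that by (intro Henstock_Kurzweil_Integration.integral_combine int) auto
    then show ?thesis using False by (simp add: primitive_def algebra_simps)
  qed
  have "((\<lambda>u. integral {-n..u} g) has_vector_derivative g t) (at t within {-n..n})"
    by (rule integral_has_vector_derivative) (auto simp: n_def intro: continuous_on_subset[OF g])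
  moreover have "at t within {-n..n} = at t"
    by (rule at_within_interior) (auto simp: n_def)
  ultimately have "((\<lambda>u. integral {-n..u} g - integral {-n..0} g) has_vector_derivative g t) (at t)"
    by (auto intro!: derivative_eq_intros)
  then show ?thesis
    by (rule has_vector_derivative_transform_within_open[of _ _ _ "{-n<..<n}"])
      (auto simp: eq n_def)
qed

text \<open>Mean value inequality against the majorant \<open>m / c * exp (c * s)\<close>, with
  reflection for negative times. The gain is the factor \<open>1 / c\<close>: a large
  \<open>c\<close> makes integration of a Lipschitz right-hand side contractive in the norm weighted
  by \<open>exp (- c * \<bar>s\<bar>)\<close>, on the whole line at once.\<close>

lemma exp_growth_bound:
  fixes D :: "real \<Rightarrow> 'a::real_normed_vector"
  assumes D: "\<And>s. (D has_vector_derivative D' s) (at s)" and D0: "D 0 = 0"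
    and c: "c > 0" and m: "m \<ge> 0"
    and bd: "\<And>s. \<bar>s\<bar> \<le> \<bar>t\<bar> \<Longrightarrow> norm (D' s) \<le> m * exp (c * \<bar>s\<bar>)"
  shows "norm (D t) \<le> m / c * exp (c * \<bar>t\<bar>)"
proof -
  have pos: "norm (E t) \<le> m / c * exp (c * t)"
    if E: "\<And>s. (E has_vector_derivative E' s) (at s)" and E0: "E 0 = 0" and t: "t > 0"
      and bd: "\<And>s. 0 < s \<Longrightarrow> s < t \<Longrightarrow> norm (E' s) \<le> m * exp (c * s)"
    for E E' :: "real \<Rightarrow> 'a" and t
  proof -
    have "norm (E t - E 0) \<le> m / c * exp (c * t) - m / c * exp (c * 0)"
    proof (rule differentiable_bound_general[OF t])
      show "continuous_on {0..t} (\<lambda>s. m / c * exp (c * s))" by (intro continuous_intros)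
      show "((\<lambda>s. m / c * exp (c * s)) has_vector_derivative m * exp (c * s)) (at s)" for s
        unfolding has_real_derivative_iff_has_vector_derivative[symmetric]
        by (rule derivative_eq_intros refl)+ (use c in auto)
    qed (auto intro: E bd continuous_on_UNIV_has_vector_derivative[OF E])
    moreover have "m / c * exp (c * 0) \<ge> 0" using c m by simp
    ultimately show ?thesis using E0 by simp
  qed
  consider "t = 0" | "t > 0" | "t < 0" by linarith
  then show ?thesis
  proof cases
    case 1 then show ?thesis using c m D0 by simp
  next
    case 2
    have "norm (D t) \<le> m / c * exp (c * t)"
      by (rule pos[OF D D0 2]) (use bd 2 in \<open>metis abs_of_pos less_imp_le\<close>)
    with 2 show ?thesis by simp
  next
    case 3
    have bd': "norm (D' (- s)) \<le> m * exp (c * s)" if "0 < s" "s < - t" for s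
      using bd[of "- s"] that by simp
    have "norm (D (- (- t))) \<le> m / c * exp (c * (- t))"
      by (rule pos[of "\<lambda>s. D (- s)" "\<lambda>s. - D' (- s)" "- t"])
        (use 3 D0 bd' in \<open>auto intro!: has_vector_derivative_reflect D\<close>)
    then show ?thesis using 3 by simp
  qed
qed

text \<open>At a maximum point \<open>s\<close> of the weighted norm on
  \<open>{-\<bar>t\<bar>..\<bar>t\<bar>}\<close> the growth bound gives
  \<open>norm (d s) \<le> \<bar>M\<bar> / c * norm (d s)\<close>, so the maximum is 0.\<close>

lemma ode_unique:
  fixes d :: "real \<Rightarrow> 'a::real_normed_vector"
  assumes d: "\<And>s. (d has_vector_derivative d' s) (at s)" and d0: "d 0 = 0"
    and bd: "\<And>s. norm (d' s) \<le> M * norm (d s)"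
  shows "d t = 0"
proof -
  \<comment> \<open>Large enough for \<open>\<bar>M\<bar> / c < 1/2\<close>, and positive even if
    \<open>M = 0\<close>.\<close>
  define c where "c = 2 * \<bar>M\<bar> + 1"
  let ?w = "\<lambda>s. exp (- c * \<bar>s\<bar>) * norm (d s)"
  have "continuous_on {-\<bar>t\<bar>..\<bar>t\<bar>} ?w"
    by (intro continuous_intros continuous_on_UNIV_has_vector_derivative[OF d])
  then obtain s where s: "s \<in> {-\<bar>t\<bar>..\<bar>t\<bar>}" "\<And>r. r \<in> {-\<bar>t\<bar>..\<bar>t\<bar>} \<Longrightarrow> ?w r \<le> ?w s"
    using continuous_attains_sup[of "{-\<bar>t\<bar>..\<bar>t\<bar>}" ?w] by auto
  have c: "c > 0" by (simp add: c_def)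
  have "norm (d s) \<le> \<bar>M\<bar> * ?w s / c * exp (c * \<bar>s\<bar>)"
  proof (rule exp_growth_bound[OF d d0 c])
    show "norm (d' r) \<le> \<bar>M\<bar> * ?w s * exp (c * \<bar>r\<bar>)" if "\<bar>r\<bar> \<le> \<bar>s\<bar>" for r
    proof -
      have "?w r \<le> ?w s" by (rule s(2)) (use s(1) that in auto)
      then have "exp (c * \<bar>r\<bar>) * ?w r \<le> exp (c * \<bar>r\<bar>) * ?w s" by simp
      then have "norm (d r) \<le> exp (c * \<bar>r\<bar>) * ?w s"
        unfolding mult.assoc[symmetric] exp_add[symmetric] by simp
      then have "\<bar>M\<bar> * norm (d r) \<le> \<bar>M\<bar> * (exp (c * \<bar>r\<bar>) * ?w s)" by (rule mult_left_mono) simp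
      moreover have "norm (d' r) \<le> \<bar>M\<bar> * norm (d r)"
        by (rule order.trans[OF bd], rule mult_right_mono) auto
      ultimately show ?thesis by (simp add: mult_ac)
    qed
  qed simp
  also have "\<dots> = \<bar>M\<bar> / c * norm (d s)" by (simp add: exp_minus)
  finally have "norm (d s) * (1 - \<bar>M\<bar> / c) \<le> 0" by (simp add: algebra_simps)
  moreover have "1 - \<bar>M\<bar> / c > 0" using c by (simp add: c_def)
  ultimately have "norm (d s) = 0" by (simp add: mult_le_0_iff)
  moreover have "?w t \<le> ?w s" by (rule s(2)) auto
  ultimately have "?w t \<le> 0" by simp
  then show ?thesis by (simp add: mult_le_0_iff)
qed

text \<open>Picard iteration in the bounded variable
  \<open>y = exp (- c * \<bar>t\<bar>) *\<^sub>R x\<close>: with this weight the integral operator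
  is a contraction globally in time, so no local solutions have to be continued.\<close>

lemma ode_exists:
  fixes B :: "real \<Rightarrow> 'a::banach \<Rightarrow> 'a"
  assumes cont: "\<And>x. continuous_on UNIV x \<Longrightarrow> continuous_on UNIV (\<lambda>t. B t (x t))"
    and lip: "\<And>t x y. norm (B t x - B t y) \<le> M * norm (x - y)"
    and B0: "\<And>t. B t 0 = 0"
  shows "\<exists>x. x 0 = x0 \<and> (\<forall>t. (x has_vector_derivative B t (x t)) (at t))"
proof -
  have M: "norm (B t x - B t y) \<le> \<bar>M\<bar> * norm (x - y)" for t x y
    by (rule order.trans[OF lip], rule mult_right_mono) auto
  define c where "c = 2 * \<bar>M\<bar> + 1"
  have c: "c > 0" by (simp add: c_def)
  have Mc: "\<bar>M\<bar> / c \<le> 1/2" using c by (simp add: divide_simps) (simp add: c_def)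
  let ?b = "\<lambda>y::real \<Rightarrow>\<^sub>C 'a. \<lambda>s. B s (exp (c * \<bar>s\<bar>) *\<^sub>R y s)"
  have contb: "continuous_on UNIV (?b y)" for y
    by (intro cont continuous_intros continuous_on_apply_bcontfun)
  note deriv = has_vector_derivative_primitive[OF contb]
  have diff: "norm (primitive (?b y) t - primitive (?b z) t)
      \<le> \<bar>M\<bar> * norm (y - z) / c * exp (c * \<bar>t\<bar>)" for y z t
  proof (rule exp_growth_bound[where D = "\<lambda>t. primitive (?b y) t - primitive (?b z) t"])
    show "norm (?b y s - ?b z s) \<le> \<bar>M\<bar> * norm (y - z) * exp (c * \<bar>s\<bar>)" for s
    proof -
      have "norm (?b y s - ?b z s) \<le> \<bar>M\<bar> * (exp (c * \<bar>s\<bar>) * norm (y s - z s))"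
        using M[of s "exp (c * \<bar>s\<bar>) *\<^sub>R y s" "exp (c * \<bar>s\<bar>) *\<^sub>R z s"]
        by (simp flip: scaleR_diff_right)
      also have "\<dots> \<le> \<bar>M\<bar> * (exp (c * \<bar>s\<bar>) * norm (y - z))"
        using norm_bounded[of "y - z" s] by (intro mult_left_mono) auto
      finally show ?thesis by (simp add: mult_ac)
    qed
  qed (intro has_vector_derivative_diff deriv | use c in simp)+
  define T where "T y = Bcontfun (\<lambda>t. exp (- c * \<bar>t\<bar>) *\<^sub>R (x0 + primitive (?b y) t))" for y
  have T: "T y t = exp (- c * \<bar>t\<bar>) *\<^sub>R (x0 + primitive (?b y) t)" for y t
  proof -
    have "(\<lambda>t. exp (- c * \<bar>t\<bar>) *\<^sub>R (x0 + primitive (?b y) t)) \<in> bcontfun"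
    proof (rule bcontfun_normI)
      show "continuous_on UNIV (\<lambda>t. exp (- c * \<bar>t\<bar>) *\<^sub>R (x0 + primitive (?b y) t))"
        by (intro continuous_intros continuous_on_UNIV_has_vector_derivative[OF deriv])
      fix t
      \<comment> \<open>As \<open>B\<close> vanishes at 0, comparison with the zero function turns
        the Lipschitz estimate \<open>diff\<close> into boundedness of the weighted image.\<close>
      have p0: "primitive (?b 0) t = 0" by (simp add: B0 primitive_def)
      have "norm (primitive (?b y) t) \<le> \<bar>M\<bar> * norm y / c * exp (c * \<bar>t\<bar>)"
        using diff[of y t 0] p0 by simp
      then have "exp (- c * \<bar>t\<bar>) * norm (primitive (?b y) t)
          \<le> exp (- c * \<bar>t\<bar>) * (\<bar>M\<bar> * norm y / c * exp (c * \<bar>t\<bar>))"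
        by (rule mult_left_mono) simp
      also have "\<dots> = \<bar>M\<bar> * norm y / c" by (simp add: exp_minus)
      finally have 1: "exp (- c * \<bar>t\<bar>) * norm (primitive (?b y) t) \<le> \<bar>M\<bar> * norm y / c" .
      have 2: "exp (- c * \<bar>t\<bar>) * norm x0 \<le> norm x0"
        using c by (intro mult_left_le_one_le) auto
      have "norm (exp (- c * \<bar>t\<bar>) *\<^sub>R (x0 + primitive (?b y) t))
          \<le> exp (- c * \<bar>t\<bar>) * (norm x0 + norm (primitive (?b y) t))"
        by (simp add: norm_triangle_ineq)
      also have "\<dots> \<le> norm x0 + \<bar>M\<bar> * norm y / c" using 1 2 by (simp add: distrib_left)
      finally show "norm (exp (- c * \<bar>t\<bar>) *\<^sub>R (x0 + primitive (?b y) t)) \<le> norm x0 + \<bar>M\<bar> * norm y / c" .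
    qed
    then show ?thesis by (simp add: T_def Bcontfun_inverse)
  qed
  have "dist (T y) (T z) \<le> 1/2 * dist y z" for y z
  proof (rule dist_bound)
    fix t
    have "dist (T y t) (T z t) = exp (- c * \<bar>t\<bar>) * norm (primitive (?b y) t - primitive (?b z) t)"
      by (simp add: T dist_norm flip: scaleR_diff_right)
    also have "\<dots> \<le> exp (- c * \<bar>t\<bar>) * (\<bar>M\<bar> * norm (y - z) / c * exp (c * \<bar>t\<bar>))"
      by (intro mult_left_mono diff) simp
    also have "\<dots> = \<bar>M\<bar> / c * norm (y - z)" by (simp add: exp_minus)
    also have "\<dots> \<le> 1/2 * norm (y - z)" by (intro mult_right_mono Mc) simp
    finally show "dist (T y t) (T z t) \<le> 1/2 * dist y z" by (simp add: dist_norm)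
  qed
  then obtain y where y: "T y = y"
    using banach_fix_type[of "1/2" T] by auto
  define x where "x t = x0 + primitive (?b y) t" for t
  have "exp (c * \<bar>t\<bar>) *\<^sub>R y t = x t" for t
  proof -
    have "exp (c * \<bar>t\<bar>) *\<^sub>R y t = exp (c * \<bar>t\<bar>) *\<^sub>R exp (- c * \<bar>t\<bar>) *\<^sub>R x t"
      using T[of y t] unfolding y x_def by (rule arg_cong)
    then show ?thesis by (simp add: exp_minus)
  qed
  then have "((\<lambda>t. x0 + primitive (?b y) t) has_vector_derivative 0 + B t (x t)) (at t)" for t
    using deriv[of y t] by (intro has_vector_derivative_add has_vector_derivative_const) simp
  then have "(x has_vector_derivative B t (x t)) (at t)" for t
    unfolding x_def[abs_def] by simp
  moreover have "x 0 = x0" by (simp add: x_def)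
  ultimately show ?thesis by blast
qed

section \<open>Operator-valued equations and the Cauchy operator\<close>

lemmas has_vector_derivative_blinfun_compose =
  bounded_bilinear.has_vector_derivative[OF bounded_bilinear_blinfun_compose]

lemmas blinfun_compose_bilinear_simps =
  bounded_bilinear.add_left[OF bounded_bilinear_blinfun_compose]
  bounded_bilinear.add_right[OF bounded_bilinear_blinfun_compose]
  bounded_bilinear.diff_left[OF bounded_bilinear_blinfun_compose]
  bounded_bilinear.diff_right[OF bounded_bilinear_blinfun_compose]
  bounded_bilinear.minus_left[OF bounded_bilinear_blinfun_compose]
  bounded_bilinear.minus_right[OF bounded_bilinear_blinfun_compose]

lemma blinfun_compose_assoc: "(X o\<^sub>L Y) o\<^sub>L Z = X o\<^sub>L (Y o\<^sub>L Z)"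
  by (rule blinfun_eqI) simp

text \<open>\<open>V\<close> solves the adjoint equation, so \<open>V t o\<^sub>L U t\<close> has
  derivative 0. In infinite dimensions a left inverse need not be a right inverse; hence
  \<open>Z t = (U t o\<^sub>L V t) - id_blinfun\<close> is treated separately: it solves
  \<open>Z' = A Z - Z A\<close> with \<open>Z 0 = 0\<close>, and uniqueness applies.\<close>

lemma fundamental_solution:
  fixes A :: "real \<Rightarrow> 'a::banach \<Rightarrow>\<^sub>L 'a"
  assumes A: "continuous_on UNIV A" and M: "\<And>t. norm (A t) \<le> M"
  obtains U V where "U 0 = id_blinfun"
    and "\<And>t. (U has_vector_derivative A t o\<^sub>L U t) (at t)"
    and "\<And>t. (V has_vector_derivative - (V t o\<^sub>L A t)) (at t)"
    and "\<And>t. U t o\<^sub>L V t = id_blinfun" and "\<And>t. V t o\<^sub>L U t = id_blinfun"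
proof -
  note bil = blinfun_compose_bilinear_simps
  have M0: "M \<ge> 0" using M[of 0] norm_ge_zero[of "A 0"] by linarith
  have AX: "norm (A t o\<^sub>L X) \<le> M * norm X" and XA: "norm (X o\<^sub>L A t) \<le> M * norm X" for t X
  proof -
    show "norm (A t o\<^sub>L X) \<le> M * norm X"
      using norm_blinfun_compose[of "A t" X] mult_right_mono[OF M[of t] norm_ge_zero[of X]]
      by linarith
    show "norm (X o\<^sub>L A t) \<le> M * norm X"
      using norm_blinfun_compose[of X "A t"] mult_left_mono[OF M[of t] norm_ge_zero[of X]]
      by (simp add: mult.commute)
  qed
  have "norm ((A t o\<^sub>L X) - (A t o\<^sub>L Y)) \<le> M * norm (X - Y)" for t and X Y :: "'a \<Rightarrow>\<^sub>L 'a"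
    using AX[of t "X - Y"] by (simp add: bil)
  then obtain U where U0: "U 0 = id_blinfun"
    and U: "\<And>t. (U has_vector_derivative A t o\<^sub>L U t) (at t)"
    using ode_exists[of "\<lambda>t X. A t o\<^sub>L X" M id_blinfun] A
    by (auto intro!: continuous_intros)
  have "norm (- (X o\<^sub>L A t) - - (Y o\<^sub>L A t)) \<le> M * norm (X - Y)" for t and X Y :: "'a \<Rightarrow>\<^sub>L 'a"
    using XA[of "X - Y" t] by (simp add: bil norm_minus_commute)
  moreover have "continuous_on UNIV (\<lambda>t. - (X t o\<^sub>L A t))" if "continuous_on UNIV X" for X
    using A that by (intro continuous_intros)
  ultimately obtain V where V0: "V 0 = id_blinfun"
    and V: "\<And>t. (V has_vector_derivative - (V t o\<^sub>L A t)) (at t)"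
    using ode_exists[of "\<lambda>t X. - (X o\<^sub>L A t)" M id_blinfun] by fastforce
  have id: "id_blinfun o\<^sub>L X = X" "X o\<^sub>L id_blinfun = X" for X :: "'a \<Rightarrow>\<^sub>L 'a"
    by (auto intro: blinfun_eqI)
  have VU: "V t o\<^sub>L U t = id_blinfun" for t
  proof -
    have "(V t o\<^sub>L U t) - id_blinfun = 0"
    proof (rule ode_unique[where M = 0])
      show "((\<lambda>t. (V t o\<^sub>L U t) - id_blinfun) has_vector_derivative 0) (at t)" for t
        by (rule derivative_eq_intros has_vector_derivative_blinfun_compose U V refl)+
          (auto simp: bil blinfun_compose_assoc)
    qed (auto simp: U0 V0 id)
    then show ?thesis by simp
  qed
  have UV: "U t o\<^sub>L V t = id_blinfun" for t
  proof -
    let ?Z = "\<lambda>t. (U t o\<^sub>L V t) - id_blinfun"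
    have "?Z t = 0"
    proof (rule ode_unique[where M = "2 * M"])
      show "(?Z has_vector_derivative (A t o\<^sub>L ?Z t) - (?Z t o\<^sub>L A t)) (at t)" for t
        by (rule derivative_eq_intros has_vector_derivative_blinfun_compose U V refl)+
          (auto simp: bil blinfun_compose_assoc id)
      show "norm ((A t o\<^sub>L ?Z t) - (?Z t o\<^sub>L A t)) \<le> 2 * M * norm (?Z t)" for t
        using norm_triangle_ineq4[of "A t o\<^sub>L ?Z t" "?Z t o\<^sub>L A t"] AX[of t "?Z t"] XA[of "?Z t" t]
        by linarith
    qed (auto simp: U0 V0 id)
    then show ?thesis by simp
  qed
  show thesis by (rule that[OF U0 U V UV VU])
qed

lemma blinfun_inv_eqI:
  assumes "S o\<^sub>L T = id_blinfun" "T o\<^sub>L S = id_blinfun"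
  shows "blinfun_inv T = S"
  unfolding blinfun_inv_def
proof (rule the_equality)
  fix R assume "R o\<^sub>L T = id_blinfun \<and> T o\<^sub>L R = id_blinfun"
  then have "S = (R o\<^sub>L T) o\<^sub>L S" by (auto intro: blinfun_eqI)
  also have "\<dots> = R" using assms(2) by (auto simp: blinfun_compose_assoc intro: blinfun_eqI)
  finally show "R = S" ..
qed (use assms in simp)

text \<open>The definite description requires differentiability only along each vector, so
  uniqueness is proved for \<open>W t x - U t x\<close> with \<open>x\<close> fixed.\<close>

lemma cauchy_op_eqI:
  fixes A :: "real \<Rightarrow> 'a::banach \<Rightarrow>\<^sub>L 'a"
  assumes M: "\<And>t. norm (A t) \<le> M" and U0: "U 0 = id_blinfun"
    and U: "\<And>t. (U has_vector_derivative A t o\<^sub>L U t) (at t)"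
  shows "cauchy_op A = U"
  unfolding cauchy_op_def
proof (rule the_equality, intro conjI allI)
  show *: "((\<lambda>s. U s x) has_vector_derivative A t (U t x)) (at t)" for x t
    using blinfun.has_vector_derivative[OF U has_vector_derivative_const, of x t]
    by (simp add: blinfun.bilinear_simps)
  fix W assume W: "W 0 = id_blinfun \<and>
    (\<forall>x t. ((\<lambda>s. blinfun_apply (W s) x) has_vector_derivative A t (W t x)) (at t))"
  have "W t x - U t x = 0" for t x
  proof (rule ode_unique[where M = M])
    show "((\<lambda>t. W t x - U t x) has_vector_derivative A t (W t x - U t x)) (at t)" for t
      unfolding blinfun.diff_right
      by (rule has_vector_derivative_diff) (use W * in blast)+
    show "norm (A t (W t x - U t x)) \<le> M * norm (W t x - U t x)" for t
      using norm_blinfun[of "A t" "W t x - U t x"]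
        mult_right_mono[OF M[of t] norm_ge_zero[of "W t x - U t x"]] by linarith
  qed (use W U0 in auto)
  then show "W = U" by (intro ext blinfun_eqI) auto
qed (use U0 in auto)

section \<open>Bounded solutions under an exponential dichotomy\<close>

text \<open>Supplies the values at infinity of the primitives from which bounded solutions are
  built; integer samples suffice, since estimates are passed to the limit along a sequence.\<close>

lemma convergent_exp_decay:
  fixes r :: "real \<Rightarrow> 'a::banach"
  assumes \<nu>: "\<nu> > 0"
    and r: "\<And>a b. 0 \<le> a \<Longrightarrow> a < b \<Longrightarrow> norm (r b - r a) \<le> C * exp (- \<nu> * a)"
  obtains z where "(\<lambda>n. r (real n)) \<longlonglongrightarrow> z"
proof -
  have lim: "(\<lambda>n. C * exp (- \<nu> * real n)) \<longlonglongrightarrow> 0"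
    using \<nu> by real_asymp
  have "Cauchy (\<lambda>n. r (real n))"
  proof (rule metric_CauchyI)
    fix e :: real assume "e > 0"
    then obtain M where M: "\<And>n. n \<ge> M \<Longrightarrow> \<bar>C * exp (- \<nu> * real n)\<bar> < e"
      using LIMSEQ_D[OF lim] by (metis diff_zero real_norm_def)
    have *: "dist (r (real m)) (r (real n)) < e" if "m \<ge> M" "m < n" for m n
      using r[of "real m" "real n"] M[of m] that by (auto simp: dist_norm norm_minus_commute)
    show "\<exists>M. \<forall>m\<ge>M. \<forall>n\<ge>M. dist (r (real m)) (r (real n)) < e"
    proof (intro exI allI impI)
      fix m n assume "m \<ge> M" "n \<ge> M"
      then show "dist (r (real m)) (r (real n)) < e"
        using *[of m n] *[of n m] \<open>e > 0\<close>
        by (cases m n rule: linorder_cases) (auto simp: dist_commute)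
    qed
  qed
  then show thesis using that Cauchy_convergent_iff convergent_def by blast
qed

lemma has_integral_exp_minus_abs:
  assumes a: "a > 0"
  shows "((\<lambda>s::real. exp (- a * \<bar>t - s\<bar>)) has_integral 2 / a) UNIV"
proof -
  have half: "((\<lambda>s. exp (- a * \<bar>u - s\<bar>)) has_integral 1 / a) {u..}" for u
  proof -
    have eq: "exp (a * u) * (exp (- a * u) / a) = 1 / a" by (simp add: exp_minus)
    have "((\<lambda>s. exp (a * u) * exp (- a * s)) has_integral exp (a * u) * (exp (- a * u) / a)) {u..}"
      by (intro has_integral_mult_right has_integral_exp_minus_to_infinity a)
    then have "((\<lambda>s. exp (a * u) * exp (- a * s)) has_integral 1 / a) {u..}"
      unfolding eq .
    then show ?thesis
      by (rule has_integral_eq[rotated]) (auto simp: exp_add[symmetric] algebra_simps)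
  qed
  have half': "((\<lambda>s. exp (- a * \<bar>t - s\<bar>)) has_integral 1 / a) {..t}"
  proof -
    have "uminus ` {..t} \<subseteq> {- t..}" "uminus ` {- t..} \<subseteq> {..t}" by auto
    from has_absolute_integral_reflect_real[OF this, of "\<lambda>s. exp (- a * \<bar>- t - s\<bar>)" "1 / a"]
    have "(\<lambda>s. exp (- a * \<bar>- t - (- s)\<bar>)) absolutely_integrable_on {..t} \<and>
        integral {..t} (\<lambda>s. exp (- a * \<bar>- t - (- s)\<bar>)) = 1 / a"
      using half[of "- t"]
      by (auto simp: has_integral_iff intro!: nonnegative_absolutely_integrable_1)
    moreover have "\<bar>- t - (- s)\<bar> = \<bar>t - s\<bar>" for s by simp
    ultimately show ?thesis
      using set_lebesgue_integral_eq_integral(1) by (simp only: has_integral_iff) blast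
  qed
  have "{..t} \<inter> {t..} = {t}" "{..t} \<union> {t..} = UNIV" by auto
  then show ?thesis using has_integral_Un[OF half' half[of t]] by simp
qed

text \<open>\<open>U\<close> and \<open>V\<close> stand for the Cauchy operator and its inverse,
  given by differential equations so that no definite description has to be unfolded.\<close>

locale dichotomy =
  fixes A U V :: "real \<Rightarrow> 'a::banach \<Rightarrow>\<^sub>L 'a" and P :: "'a \<Rightarrow>\<^sub>L 'a" and N \<nu> :: real
  assumes U_0: "U 0 = id_blinfun"
    and U_deriv: "\<And>t. (U has_vector_derivative A t o\<^sub>L U t) (at t)"
    and V_deriv: "\<And>t. (V has_vector_derivative - (V t o\<^sub>L A t)) (at t)"
    and UV: "\<And>t. U t o\<^sub>L V t = id_blinfun"
    and N: "N \<ge> 1" and \<nu>: "\<nu> > 0"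
    and stable: "\<And>t \<tau>. t > \<tau> \<Longrightarrow> norm (U t o\<^sub>L P o\<^sub>L V \<tau>) \<le> N * exp (- \<nu> * (t - \<tau>))"
    and unstable: "\<And>t \<tau>. t < \<tau> \<Longrightarrow>
      norm (U t o\<^sub>L (id_blinfun - P) o\<^sub>L V \<tau>) \<le> N * exp (\<nu> * (t - \<tau>))"
begin

section \<open>Green representation and weighted estimates\<close>

definition G :: "real \<Rightarrow> real \<Rightarrow> 'a \<Rightarrow>\<^sub>L 'a" where
  "G t \<tau> = (if t > \<tau> then U t o\<^sub>L P o\<^sub>L V \<tau>
    else if t < \<tau> then - (U t o\<^sub>L (id_blinfun - P) o\<^sub>L V \<tau>) else 0)"

lemma norm_G: "norm (G t \<tau>) \<le> N * exp (- \<nu> * \<bar>t - \<tau>\<bar>)"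
  using stable[of \<tau> t] unstable[of t \<tau>] N
  by (cases t \<tau> rule: linorder_cases) (auto simp: G_def algebra_simps)

lemma UV_apply [simp]: "U t (V t x) = x"
  using arg_cong[OF UV[of t], of "\<lambda>T. blinfun_apply T x"] by simp

lemma has_vector_derivative_V_apply:
  assumes "(w has_vector_derivative A s (w s) + g s) (at s)"
  shows "((\<lambda>\<tau>. V \<tau> (w \<tau>)) has_vector_derivative V s (g s)) (at s)"
  using blinfun.has_vector_derivative[OF V_deriv assms]
  by (simp add: blinfun.bilinear_simps)

text \<open>Since \<open>V \<tau> (w \<tau>)\<close> has derivative
  \<open>V \<tau> (g \<tau>)\<close>, the fundamental theorem of calculus evaluates the integral on
  each side of \<open>t\<close>. The two contributions at \<open>t\<close> add up through
  \<open>P\<close> and \<open>id_blinfun - P\<close> to \<open>w t\<close>; those at the outer ends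
  vanish at infinity, as \<open>w\<close> is bounded and \<open>G\<close> decays.\<close>

lemma has_integral_green:
  assumes w: "\<And>t. (w has_vector_derivative A t (w t) + g t) (at t)"
    and W: "\<And>t. norm (w t) \<le> W"
  shows "((\<lambda>\<tau>. G t \<tau> (g \<tau>)) has_integral w t) UNIV"
proof -
  have W0: "W \<ge> 0" using W[of 0] norm_ge_zero[of "w 0"] by linarith
  have ftc: "((\<lambda>\<tau>. (U t o\<^sub>L Q o\<^sub>L V \<tau>) (g \<tau>)) has_integral
      (U t o\<^sub>L Q o\<^sub>L V b) (w b) - (U t o\<^sub>L Q o\<^sub>L V a) (w a)) {a..b}" if "a \<le> b" for a b Q
  proof (rule fundamental_theorem_of_calculus[OF that])
    show "((\<lambda>\<tau>. (U t o\<^sub>L Q o\<^sub>L V \<tau>) (w \<tau>)) has_vector_derivative (U t o\<^sub>L Q o\<^sub>L V s) (g s))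
        (at s within {a..b})" for s
      using bounded_linear.has_vector_derivative[OF blinfun.bounded_linear_right[of "U t o\<^sub>L Q"]
          has_vector_derivative_V_apply[of w s g]] w[of s]
      by (auto intro: has_vector_derivative_at_within)
  qed
  have split: "((\<lambda>\<tau>. G t \<tau> (g \<tau>)) has_integral w t + G t b (w b) - G t a (w a)) {a..b}"
    if ab: "a < t" "t < b" for a b
  proof -
    \<comment> \<open>The diagonal value 0 of \<open>G\<close> departs from the formula for
      \<open>\<tau> < t\<close> only at the endpoint \<open>t\<close>.\<close>
    have "((\<lambda>\<tau>. G t \<tau> (g \<tau>)) has_integral
        (U t o\<^sub>L P o\<^sub>L V t) (w t) - (U t o\<^sub>L P o\<^sub>L V a) (w a)) {a..t}"
      by (rule has_integral_spike_finite[OF _ _ ftc, of "{t}"]) (use ab in \<open>auto simp: G_def\<close>)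
    moreover have "((\<lambda>\<tau>. G t \<tau> (g \<tau>)) has_integral
        - ((U t o\<^sub>L (id_blinfun - P) o\<^sub>L V b) (w b) - (U t o\<^sub>L (id_blinfun - P) o\<^sub>L V t) (w t))) {t..b}"
      by (rule has_integral_spike_finite[OF _ _ has_integral_neg[OF ftc], of "{t}"])
        (use ab in \<open>auto simp: G_def blinfun.bilinear_simps\<close>)
    ultimately have "((\<lambda>\<tau>. G t \<tau> (g \<tau>)) has_integral
        ((U t o\<^sub>L P o\<^sub>L V t) (w t) - (U t o\<^sub>L P o\<^sub>L V a) (w a)) +
        - ((U t o\<^sub>L (id_blinfun - P) o\<^sub>L V b) (w b) - (U t o\<^sub>L (id_blinfun - P) o\<^sub>L V t) (w t))) {a..b}"
      using ab by (intro has_integral_combine[of a t b]) auto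
    then show ?thesis
      using ab by (simp add: G_def blinfun.bilinear_simps algebra_simps)
  qed
  show ?thesis
  proof (subst has_integral_alt, simp, intro allI impI)
    fix e :: real assume e: "e > 0"
    have "((\<lambda>r. 2 * N * W * exp (- \<nu> * r)) \<longlongrightarrow> 0) at_top" using \<nu> by real_asymp
    then have "\<forall>\<^sub>F r in at_top. 2 * N * W * exp (- \<nu> * r) < e"
      using e by (rule order_tendstoD)
    then obtain R where R: "R > 0" "2 * N * W * exp (- \<nu> * R) < e"
      by (metis (mono_tags, lifting) eventually_at_top_linorder eventually_conj eventually_gt_at_top order_refl)
    show "\<exists>B>0. \<forall>a b::real. ball 0 B \<subseteq> {a..b} \<longrightarrow>
        (\<exists>z. ((\<lambda>\<tau>. G t \<tau> (g \<tau>)) has_integral z) {a..b} \<and> norm (z - w t) < e)"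
    \<comment> \<open>The ball is open; the extra 1 puts the points \<open>\<bar>t\<bar> + R\<close>
      and \<open>- (\<bar>t\<bar> + R)\<close> inside it, so both ends of the interval are at least
      \<open>R\<close> away from \<open>t\<close>.\<close>
    proof (intro exI[of _ "\<bar>t\<bar> + R + 1"] conjI allI impI)
      fix a b :: real assume sub: "ball 0 (\<bar>t\<bar> + R + 1) \<subseteq> {a..b}"
      have "\<bar>t\<bar> + R \<in> {a..b}" "- (\<bar>t\<bar> + R) \<in> {a..b}"
        using R by (intro subsetD[OF sub]; simp)+
      then have a: "a \<le> t - R" and b: "t + R \<le> b" by auto
      have G: "norm (G t s (w s)) \<le> N * W * exp (- \<nu> * R)" if "\<bar>t - s\<bar> \<ge> R" for s
      proof -
        have "norm (G t s (w s)) \<le> norm (G t s) * norm (w s)" by (rule norm_blinfun)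
        also have "\<dots> \<le> (N * exp (- \<nu> * \<bar>t - s\<bar>)) * W"
          using norm_G W N by (intro mult_mono) auto
        also have "\<dots> \<le> (N * exp (- \<nu> * R)) * W"
          using N W0 \<nu> that by (intro mult_right_mono mult_left_mono) auto
        finally show ?thesis by (simp add: mult_ac)
      qed
      have "norm (w t + G t b (w b) - G t a (w a) - w t) \<le> norm (G t b (w b)) + norm (G t a (w a))"
        by (simp add: norm_triangle_ineq4)
      also have "\<dots> < e" using G[of a] G[of b] a b R by linarith
      finally show "\<exists>z. ((\<lambda>\<tau>. G t \<tau> (g \<tau>)) has_integral z) {a..b} \<and> norm (z - w t) < e"
        using split[of a b] a b R by (intro exI[of _ "w t + G t b (w b) - G t a (w a)"]) auto
    qed (use R in auto)
  qed
qed

text \<open>\<open>\<kappa>\<close> is the integral of \<open>N * exp (- \<nu> * \<bar>s\<bar> / 2)\<close> over the line.\<close>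

definition \<kappa> :: real where "\<kappa> = 4 * N / \<nu>"

lemma \<kappa>_pos: "\<kappa> > 0"
  using N \<nu> by (simp add: \<kappa>_def)

text \<open>The centre \<open>h\<close> is free and the constant does not depend on it; evaluating
  at \<open>t = h\<close>, where the weight is 1, yields ordinary supremum estimates.\<close>

lemma weighted_bound:
  assumes w: "\<And>t. (w has_vector_derivative A t (w t) + g t) (at t)"
    and W: "\<And>t. norm (w t) \<le> W"
    and m: "m \<ge> 0" and g: "\<And>\<tau>. norm (g \<tau>) \<le> m * exp (\<nu> / 2 * \<bar>\<tau> - h\<bar>)"
  shows "norm (w t) \<le> \<kappa> * m * exp (\<nu> / 2 * \<bar>t - h\<bar>)"
proof -
  let ?c = "N * m * exp (\<nu> / 2 * \<bar>t - h\<bar>)"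
  have G: "((\<lambda>\<tau>. G t \<tau> (g \<tau>)) has_integral w t) UNIV"
    by (rule has_integral_green[OF w W])
  have D: "((\<lambda>\<tau>. ?c * exp (- (\<nu> / 2) * \<bar>t - \<tau>\<bar>)) has_integral ?c * (2 / (\<nu> / 2))) UNIV"
    by (intro has_integral_mult_right has_integral_exp_minus_abs) (use \<nu> in simp)
  have "norm (integral UNIV (\<lambda>\<tau>. G t \<tau> (g \<tau>)))
      \<le> integral UNIV (\<lambda>\<tau>. ?c * exp (- (\<nu> / 2) * \<bar>t - \<tau>\<bar>))"
  proof (rule integral_norm_bound_integral[OF has_integral_integrable[OF G] has_integral_integrable[OF D]])
    fix \<tau>
    have "norm (G t \<tau> (g \<tau>)) \<le> norm (G t \<tau>) * norm (g \<tau>)" by (rule norm_blinfun)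
    also have "\<dots> \<le> (N * exp (- \<nu> * \<bar>t - \<tau>\<bar>)) * (m * exp (\<nu> / 2 * \<bar>\<tau> - h\<bar>))"
      using norm_G g N by (intro mult_mono) auto
    also have "\<dots> = N * m * exp (- \<nu> * \<bar>t - \<tau>\<bar> + \<nu> / 2 * \<bar>\<tau> - h\<bar>)"
      by (simp only: exp_add mult_ac)
    also have "\<dots> \<le> N * m * exp (\<nu> / 2 * \<bar>t - h\<bar> + - (\<nu> / 2) * \<bar>t - \<tau>\<bar>)"
    proof -
      have "\<nu> / 2 * \<bar>\<tau> - h\<bar> \<le> \<nu> / 2 * (\<bar>t - h\<bar> + \<bar>t - \<tau>\<bar>)"
        using \<nu> by (intro mult_left_mono) auto
      also have "\<dots> = \<nu> / 2 * \<bar>t - h\<bar> + \<nu> / 2 * \<bar>t - \<tau>\<bar>" by (rule distrib_left)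
      finally have "- \<nu> * \<bar>t - \<tau>\<bar> + \<nu> / 2 * \<bar>\<tau> - h\<bar> \<le> \<nu> / 2 * \<bar>t - h\<bar> + - (\<nu> / 2) * \<bar>t - \<tau>\<bar>"
        by linarith
      then show ?thesis using N m by (intro mult_left_mono) auto
    qed
    also have "\<dots> = ?c * exp (- (\<nu> / 2) * \<bar>t - \<tau>\<bar>)"
      by (simp only: exp_add mult_ac)
    finally show "norm (G t \<tau> (g \<tau>)) \<le> ?c * exp (- (\<nu> / 2) * \<bar>t - \<tau>\<bar>)" .
  qed
  then have "norm (w t) \<le> ?c * (2 / (\<nu> / 2))"
    unfolding integral_unique[OF G] integral_unique[OF D] .
  also have "\<dots> = \<kappa> * m * exp (\<nu> / 2 * \<bar>t - h\<bar>)" by (simp add: \<kappa>_def)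
  finally show ?thesis .
qed

text \<open>Absorption: boundedness of \<open>w\<close> makes the weighted supremum \<open>S\<close>
  finite, so \<open>S \<le> \<kappa> * m + 1/4 * S\<close> can be solved for \<open>S\<close>; the
  factor 2 is a round bound for 4/3.\<close>

lemma perturbed_weighted_bound:
  assumes w: "\<And>t. (w has_vector_derivative A t (w t) + g t) (at t)"
    and W: "\<And>t. norm (w t) \<le> W"
    and m: "m \<ge> 0" and l: "l \<ge> 0" "\<kappa> * l \<le> 1/4"
    and g: "\<And>\<tau>. norm (g \<tau>) \<le> m * exp (\<nu> / 2 * \<bar>\<tau> - h\<bar>) + l * norm (w \<tau>)"
  shows "norm (w t) \<le> 2 * \<kappa> * m * exp (\<nu> / 2 * \<bar>t - h\<bar>)"
proof -
  let ?e = "\<lambda>t. exp (\<nu> / 2 * \<bar>t - h\<bar>)"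
  define S where "S = (SUP t. norm (w t) / ?e t)"
  have e1: "?e t \<ge> 1" for t using \<nu> by simp
  have "norm (w t) / ?e t \<le> W" for t
  proof -
    have "norm (w t) / ?e t \<le> norm (w t) / 1" using e1[of t] by (intro divide_left_mono) auto
    then show ?thesis using W[of t] by simp
  qed
  then have bdd: "bdd_above (range (\<lambda>t. norm (w t) / ?e t))" by (intro bdd_aboveI) auto
  have wS: "norm (w t) \<le> S * ?e t" for t
  proof -
    have "norm (w t) / ?e t \<le> S" unfolding S_def by (rule cSUP_upper[OF _ bdd]) simp
    then show ?thesis by (simp add: divide_le_eq)
  qed
  have "0 \<le> norm (w h)" by simp
  also have "\<dots> \<le> S" using wS[of h] by simp
  finally have S0: "S \<ge> 0" .
  have "norm (g \<tau>) \<le> (m + l * S) * ?e \<tau>" for \<tau>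
    using g[of \<tau>] mult_left_mono[OF wS[of \<tau>] l(1)] by (simp add: algebra_simps)
  then have "norm (w t) \<le> \<kappa> * (m + l * S) * ?e t" for t
    using m l(1) S0 by (intro weighted_bound[OF w W]) auto
  then have "norm (w t) / ?e t \<le> \<kappa> * (m + l * S)" for t by (simp add: divide_le_eq)
  then have "S \<le> \<kappa> * (m + l * S)" unfolding S_def by (intro cSUP_least) auto
  also have "\<dots> \<le> \<kappa> * m + 1/4 * S"
    using mult_right_mono[OF l(2) S0] by (simp add: algebra_simps)
  finally have "S \<le> 2 * \<kappa> * m" using \<kappa>_pos m mult_nonneg_nonneg[of \<kappa> m] by linarith
  then have "S * ?e t \<le> 2 * \<kappa> * m * ?e t" by (intro mult_right_mono) auto
  then show ?thesis using wS[of t] by linarith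
qed

text \<open>Variation of constants. Subtracting the limit of \<open>p\<close> at minus infinity and
  that of \<open>q\<close> at plus infinity makes \<open>w\<close> the integral of \<open>g\<close>
  against the Green function, written with primitives so that no improper integral has to be
  differentiated.\<close>

lemma bounded_solution_exists:
  assumes g: "continuous_on UNIV g" and m: "\<And>t. norm (g t) \<le> m"
  obtains w where "\<And>t. (w has_vector_derivative A t (w t) + g t) (at t)"
    and "\<And>t. norm (w t) \<le> \<kappa> * m"
proof -
  have m0: "m \<ge> 0" using m[of 0] norm_ge_zero[of "g 0"] by linarith
  have contV: "continuous_on UNIV V" by (rule continuous_on_UNIV_has_vector_derivative[OF V_deriv])
  define p where "p = primitive (\<lambda>\<tau>. P (V \<tau> (g \<tau>)))"
  define q where "q = primitive (\<lambda>\<tau>. (id_blinfun - P) (V \<tau> (g \<tau>)))"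
  have p: "(p has_vector_derivative P (V t (g t))) (at t)"
    and q: "(q has_vector_derivative (id_blinfun - P) (V t (g t))) (at t)" for t
    unfolding p_def q_def using contV g
    by (auto intro!: has_vector_derivative_primitive continuous_intros)
  \<comment> \<open>The integral of \<open>N * m * exp (- \<nu> * r)\<close> over positive
    \<open>r\<close>, which bounds each half of the Green integral; \<open>\<kappa> * m\<close>
    equals \<open>4 * C\<close>.\<close>
  define C where "C = N * m / \<nu>"
  have C0: "C \<ge> 0" using N \<nu> m0 by (simp add: C_def)
  have Up: "((\<lambda>s. U t (p s)) has_vector_derivative (U t o\<^sub>L P o\<^sub>L V s) (g s)) (at s)"
    and Uq: "((\<lambda>s. U t (q s)) has_vector_derivative (U t o\<^sub>L (id_blinfun - P) o\<^sub>L V s) (g s)) (at s)"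
    for t s
    using bounded_linear.has_vector_derivative[OF blinfun.bounded_linear_right p, of "U t"]
      bounded_linear.has_vector_derivative[OF blinfun.bounded_linear_right q, of "U t"] by simp_all
  have pb: "norm (U t (p b - p a)) \<le> C * exp (\<nu> * (b - t))" if "a < b" "b \<le> t" for t a b
  proof -
    have "norm (U t (p b) - U t (p a)) \<le> C * exp (\<nu> * (b - t)) - C * exp (\<nu> * (a - t))"
    proof (rule differentiable_bound_general[OF that(1)])
      show "continuous_on {a..b} (\<lambda>s. C * exp (\<nu> * (s - t)))" by (intro continuous_intros)
      show "((\<lambda>s. C * exp (\<nu> * (s - t))) has_vector_derivative N * m * exp (\<nu> * (s - t))) (at s)" for s
        unfolding has_real_derivative_iff_has_vector_derivative[symmetric]
        by (rule derivative_eq_intros refl)+ (use \<nu> in \<open>auto simp: C_def\<close>)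
      show "norm ((U t o\<^sub>L P o\<^sub>L V s) (g s)) \<le> N * m * exp (\<nu> * (s - t))" if "a < s" "s < b" for s
      proof -
        have "norm ((U t o\<^sub>L P o\<^sub>L V s) (g s)) \<le> (N * exp (- \<nu> * (t - s))) * m"
          using \<open>s < b\<close> \<open>b \<le> t\<close> N m0
          by (intro order.trans[OF norm_blinfun] mult_mono stable m) auto
        then show ?thesis by (simp add: algebra_simps)
      qed
    qed (rule Up continuous_on_UNIV_has_vector_derivative[OF Up])+
    moreover have "C * exp (\<nu> * (a - t)) \<ge> 0" using C0 by simp
    ultimately show ?thesis by (simp add: blinfun.bilinear_simps)
  qed
  have qb: "norm (U t (q b - q a)) \<le> C * exp (\<nu> * (t - a))" if "a < b" "t \<le> a" for t a b
  proof -
    \<comment> \<open>The bound on the derivative decays in \<open>s\<close>, so its increasing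
      primitive carries the sign of \<open>- C\<close>.\<close>
    have "norm (U t (q b) - U t (q a)) \<le> (- C) * exp (\<nu> * (t - b)) - (- C) * exp (\<nu> * (t - a))"
    proof (rule differentiable_bound_general[OF that(1)])
      show "continuous_on {a..b} (\<lambda>s. (- C) * exp (\<nu> * (t - s)))" by (intro continuous_intros)
      show "((\<lambda>s. (- C) * exp (\<nu> * (t - s))) has_vector_derivative N * m * exp (\<nu> * (t - s))) (at s)" for s
        unfolding has_real_derivative_iff_has_vector_derivative[symmetric]
        by (rule derivative_eq_intros refl)+ (use \<nu> in \<open>auto simp: C_def\<close>)
      show "norm ((U t o\<^sub>L (id_blinfun - P) o\<^sub>L V s) (g s)) \<le> N * m * exp (\<nu> * (t - s))"
        if "a < s" "s < b" for s
      proof -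
        have "norm ((U t o\<^sub>L (id_blinfun - P) o\<^sub>L V s) (g s)) \<le> (N * exp (\<nu> * (t - s))) * m"
          using \<open>a < s\<close> \<open>t \<le> a\<close> N m0
          by (intro order.trans[OF norm_blinfun] mult_mono unstable m) auto
        then show ?thesis by (simp add: mult_ac)
      qed
    qed (rule Uq continuous_on_UNIV_has_vector_derivative[OF Uq])+
    moreover have "C * exp (\<nu> * (t - b)) \<ge> 0" using C0 by simp
    ultimately show ?thesis by (simp add: blinfun.bilinear_simps)
  qed
  obtain zp where zp: "(\<lambda>n. p (- real n)) \<longlonglongrightarrow> zp"
  proof (rule convergent_exp_decay[OF \<nu>, where r = "\<lambda>s. p (- s)" and C = C])
    show "norm (p (- b) - p (- a)) \<le> C * exp (- \<nu> * a)" if "0 \<le> a" "a < b" for a b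
      using pb[of "- b" "- a" 0] that by (simp add: U_0 norm_minus_commute)
  qed
  obtain zq where zq: "(\<lambda>n. q (real n)) \<longlonglongrightarrow> zq"
  proof (rule convergent_exp_decay[OF \<nu>, where r = q and C = C])
    show "norm (q b - q a) \<le> C * exp (- \<nu> * a)" if "0 \<le> a" "a < b" for a b
      using qb[of a b 0] that by (simp add: U_0)
  qed
  have p_bd: "norm (U t (p t - zp)) \<le> C" for t
  proof (rule tendsto_upperbound)
    show "(\<lambda>n. norm (U t (p t - p (- real n)))) \<longlonglongrightarrow> norm (U t (p t - zp))"
      by (intro tendsto_intros zp)
    have "\<forall>\<^sub>F n in sequentially. real n > - t"
      using filterlim_real_sequentially unfolding filterlim_at_top_dense by blast
    then show "\<forall>\<^sub>F n in sequentially. norm (U t (p t - p (- real n))) \<le> C"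
      by eventually_elim (use pb[of _ t t] in auto)
  qed simp
  have q_bd: "norm (U t (q t - zq)) \<le> C" for t
  proof (rule tendsto_upperbound)
    show "(\<lambda>n. norm (U t (q t - q (real n)))) \<longlonglongrightarrow> norm (U t (q t - zq))"
      by (intro tendsto_intros zq)
    have "\<forall>\<^sub>F n in sequentially. real n > t"
      using filterlim_real_sequentially unfolding filterlim_at_top_dense by blast
    then show "\<forall>\<^sub>F n in sequentially. norm (U t (q t - q (real n))) \<le> C"
      by eventually_elim (use qb[of t _ t] in \<open>auto simp: norm_minus_commute[of "q t"] norm_minus_commute[of "U t (q t)"] blinfun.diff_right\<close>)
  qed simp
  define w where "w t = U t ((p t - zp) + (q t - zq))" for t
  show thesis
  proof
    fix t
    have "((\<lambda>t. (p t - zp) + (q t - zq)) has_vector_derivative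
        (P (V t (g t)) - 0) + ((id_blinfun - P) (V t (g t)) - 0)) (at t)"
      by (intro has_vector_derivative_add has_vector_derivative_diff p q has_vector_derivative_const)
    from blinfun.has_vector_derivative[OF U_deriv this]
    show "(w has_vector_derivative A t (w t) + g t) (at t)"
      unfolding w_def[abs_def] by (simp add: blinfun.bilinear_simps add.commute)
    have "norm (w t) \<le> C + C"
      unfolding w_def blinfun.add_right by (rule norm_triangle_mono[OF p_bd q_bd])
    also have "\<dots> \<le> \<kappa> * m" using C0 by (simp add: \<kappa>_def C_def)
    finally show "norm (w t) \<le> \<kappa> * m" .
  qed
qed

end

section \<open>Translates and precompactness\<close>

text \<open>
  Precompactness of a set of translates is expressed by finite colourings of the translation
  parameters for which parameters of equal colour have close translates; colourings combine and
  transfer from one function to another without passing to subsequences.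
\<close>

definition finite_colouring :: "('h \<Rightarrow> 'h \<Rightarrow> bool) \<Rightarrow> bool" where
  "finite_colouring R \<longleftrightarrow> (\<exists>c :: 'h \<Rightarrow> nat. finite (range c) \<and> (\<forall>h k. c h = c k \<longrightarrow> R h k))"

lemma finite_colouring_mono:
  assumes "finite_colouring R" "\<And>h k. R h k \<Longrightarrow> Q h k"
  shows "finite_colouring Q"
  using assms unfolding finite_colouring_def by blast

text \<open>Colours are numbers in the definition because an existential cannot range over types;
  numbering the finite set \<open>D\<close> allows functions or pairs as colours.\<close>

lemma finite_colouringI:
  assumes D: "finite D" and l: "\<And>h. l h \<in> D" and R: "\<And>h k. l h = l k \<Longrightarrow> R h k"
  shows "finite_colouring R"
  unfolding finite_colouring_def
proof (intro exI conjI allI impI)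
  have "range (\<lambda>h. to_nat_on D (l h)) \<subseteq> to_nat_on D ` D" using l by auto
  then show "finite (range (\<lambda>h. to_nat_on D (l h)))" using D finite_subset by blast
  fix h k assume "to_nat_on D (l h) = to_nat_on D (l k)"
  then have "l h = l k"
    by (rule inj_onD[OF inj_on_to_nat_on[OF countable_finite[OF D]] _ l l])
  then show "R h k" by (rule R)
qed

lemma finite_colouring_conj:
  assumes "finite_colouring R" "finite_colouring Q"
  shows "finite_colouring (\<lambda>h k. R h k \<and> Q h k)"
proof -
  obtain c d :: "'a \<Rightarrow> nat" where c: "finite (range c)" "\<And>h k. c h = c k \<Longrightarrow> R h k"
    and d: "finite (range d)" "\<And>h k. d h = d k \<Longrightarrow> Q h k"
    using assms unfolding finite_colouring_def by auto
  show ?thesis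
    by (rule finite_colouringI[of "range c \<times> range d" "\<lambda>h. (c h, d h)"]) (use c d in auto)
qed

text \<open>Finitely many neighbourhoods, each within \<open>e / 2\<close> of its centre on
  \<open>K\<close>, cover the compact closure; a parameter is coloured by the centre of one that
  contains its translate.\<close>

lemma lagrange_stable_imp_finite_colouring:
  fixes T :: "real \<Rightarrow> 's::t2_space \<Rightarrow> 'e::metric_space"
  assumes T: "lagrange_stable (compact_open S) T" and K: "compact K" "K \<subseteq> S" and e: "e > 0"
  shows "finite_colouring (\<lambda>h k. \<forall>x\<in>K. dist (T h x) (T k x) < e)"
proof -
  let ?X = "compact_open S :: ('s \<Rightarrow> 'e) topology"
  let ?C = "?X closure_of range T"
  have comp: "compactin ?X ?C" and "range T \<subseteq> topspace ?X"
    using T unfolding lagrange_stable_def precompact_in_def by simp_all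
  from closure_of_subset[OF this(2)] have sub: "T h \<in> ?C" for h by blast
  have "\<exists>W. openin ?X W \<and> l \<in> W \<and> (\<forall>g\<in>W. \<forall>x\<in>K. dist (g x) (l x) < e / 2)" if "l \<in> ?C" for l
  proof -
    have l: "l \<in> topspace ?X" using that in_closure_of by fast
    \<comment> \<open>The identity tends to \<open>l\<close> along the neighbourhood filter, so the
      characterisation of limits becomes a statement about neighbourhoods.\<close>
    have "limitin ?X (\<lambda>g. g) l (nhdsin ?X l)"
      using l unfolding limitin_def eventually_nhdsin by blast
    then have "uniform_limit K (\<lambda>g. g) l (nhdsin ?X l)"
      using K unfolding limitin_compact_open by blast
    then have "\<forall>\<^sub>F g in nhdsin ?X l. \<forall>x\<in>K. dist (g x) (l x) < e / 2"
      using e by (intro uniform_limitD) auto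
    then show ?thesis using l unfolding eventually_nhdsin by blast
  qed
  then have "\<exists>W. \<forall>l\<in>?C. openin ?X (W l) \<and> l \<in> W l \<and>
      (\<forall>g\<in>W l. \<forall>x\<in>K. dist (g x) (l x) < e / 2)"
    by (intro bchoice ballI)
  then obtain W where W: "\<And>l. l \<in> ?C \<Longrightarrow> openin ?X (W l) \<and> l \<in> W l \<and>
      (\<forall>g\<in>W l. \<forall>x\<in>K. dist (g x) (l x) < e / 2)"
    by blast
  have "\<exists>\<F>. finite \<F> \<and> \<F> \<subseteq> W ` ?C \<and> ?C \<subseteq> \<Union>\<F>"
    by (rule compactinD[OF comp]) (use W in blast)+
  then obtain \<F> where \<F>: "finite \<F>" "\<F> \<subseteq> W ` ?C" "?C \<subseteq> \<Union>\<F>" by blast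
  obtain D where D: "D \<subseteq> ?C" "finite D" "\<F> = W ` D"
    using finite_subset_image[OF \<F>(1,2)] by blast
  have "\<forall>h. \<exists>l. l \<in> D \<and> T h \<in> W l" using sub \<F>(3) D(3) by blast
  from choice[OF this] obtain l where l: "\<And>h. l h \<in> D" "\<And>h. T h \<in> W (l h)" by blast
  show ?thesis
  proof (rule finite_colouringI[OF D(2) l(1)], intro ballI)
    fix h k x assume eq: "l h = l k" and x: "x \<in> K"
    have "dist (T h x) (l h x) < e / 2" "dist (T k x) (l h x) < e / 2"
      using W[of "l h"] l[of h] l[of k] D(1) x eq by auto
    then show "dist (T h x) (T k x) < e" by (rule dist_triangle_half_l)
  qed
qed

text \<open>Total boundedness of the set of translates for uniform convergence on compact
  intervals.\<close>

definition translation_precompact :: "(real \<Rightarrow> 'e::metric_space) \<Rightarrow> bool" where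
  "translation_precompact g \<longleftrightarrow>
    (\<forall>T. \<forall>e>0. finite_colouring (\<lambda>h k. \<forall>t\<in>{-T..T}. dist (g (t + h)) (g (t + k)) < e))"

lemma translation_precompactD:
  assumes "translation_precompact g" "e > 0"
  shows "finite_colouring (\<lambda>h k. \<forall>t\<in>{-T..T}. dist (g (t + h)) (g (t + k)) < e)"
  using assms unfolding translation_precompact_def by blast

lemma lagrange_stable_imp_translation_precompact:
  fixes g :: "real \<Rightarrow> 'e::metric_space"
  assumes "lagrange_stable (compact_open UNIV) (\<lambda>h. shift h g)"
  shows "translation_precompact g"
  unfolding translation_precompact_def
proof (intro allI impI)
  fix T e :: real assume "e > 0"
  from lagrange_stable_imp_finite_colouring[OF assms _ _ this, of "{-T..T}"]
  show "finite_colouring (\<lambda>h k. \<forall>t\<in>{-T..T}. dist (g (t + h)) (g (t + k)) < e)"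
    by (simp add: shift_def)
qed

lemma translation_precompact_compact_range:
  fixes g :: "real \<Rightarrow> 'e::complete_space"
  assumes g: "translation_precompact g"
  shows "compact (closure (range g))"
  unfolding compact_eq_totally_bounded
proof (intro conjI allI impI)
  show "complete (closure (range g))" by (simp add: complete_eq_closed)
  fix e :: real assume e: "e > 0"
  \<comment> \<open>Translates are compared at time 0 only, which compares the values of
    \<open>g\<close>; one parameter of each colour then gives a finite net.\<close>
  then have "finite_colouring (\<lambda>h k. \<forall>t\<in>{-0..0}. dist (g (t + h)) (g (t + k)) < e / 2)"
    by (intro translation_precompactD[OF g]) simp
  then obtain c :: "real \<Rightarrow> nat" where c: "finite (range c)" "\<And>h k. c h = c k \<Longrightarrow> dist (g h) (g k) < e / 2"
    unfolding finite_colouring_def by auto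
  show "\<exists>k. finite k \<and> closure (range g) \<subseteq> (\<Union>x\<in>k. ball x e)"
  proof (intro exI conjI subsetI)
    show "finite ((\<lambda>i. g (inv c i)) ` range c)" using c(1) by simp
    fix y assume "y \<in> closure (range g)"
    then have "\<forall>e>0. \<exists>x\<in>range g. dist x y < e" by (simp only: closure_approachable)
    then obtain h where h: "dist (g h) y < e / 2" using e half_gt_zero by blast
    have "dist (g (inv c (c h))) (g h) < e / 2" by (rule c(2)[OF f_inv_into_f]) simp
    then have "dist (g (inv c (c h))) y < e" using h dist_triangle[of "g (inv c (c h))" y "g h"] by linarith
    then show "y \<in> (\<Union>x\<in>(\<lambda>i. g (inv c i)) ` range c. ball x e)" by auto
  qed
qed

lemma translation_precompact_bounded:
  fixes g :: "real \<Rightarrow> 'e::{complete_space, real_normed_vector}"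
  assumes "translation_precompact g"
  obtains M where "\<And>t. norm (g t) \<le> M"
proof -
  have "bounded (range g)"
    using compact_imp_bounded[OF translation_precompact_compact_range[OF assms]] bounded_subset
      closure_subset by blast
  then show thesis using that by (auto simp: bounded_iff)
qed

section \<open>Closure properties of precompactness of translates\<close>

lemma translation_precompact_const: "translation_precompact (\<lambda>_. c)"
  unfolding translation_precompact_def
  by (intro allI impI, rule finite_colouringI[of "{0::nat}" "\<lambda>_. 0"]) auto

lemma translation_precompact_add:
  fixes f g :: "real \<Rightarrow> 'e::real_normed_vector"
  assumes "translation_precompact f" "translation_precompact g"
  shows "translation_precompact (\<lambda>t. f t + g t)"
  unfolding translation_precompact_def
proof (intro allI impI)
  fix T e :: real assume "e > 0"
  then have e: "e / 2 > 0" by simp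
  show "finite_colouring (\<lambda>h k. \<forall>t\<in>{-T..T}. dist (f (t + h) + g (t + h)) (f (t + k) + g (t + k)) < e)"
  proof (rule finite_colouring_mono[OF finite_colouring_conj[OF
          translation_precompactD[OF assms(1) e, of T] translation_precompactD[OF assms(2) e, of T]]],
      intro ballI)
    fix h k t assume *: "(\<forall>t\<in>{-T..T}. dist (f (t + h)) (f (t + k)) < e / 2) \<and>
      (\<forall>t\<in>{-T..T}. dist (g (t + h)) (g (t + k)) < e / 2)" and t: "t \<in> {-T..T}"
    then have "dist (f (t + h)) (f (t + k)) < e / 2" "dist (g (t + h)) (g (t + k)) < e / 2" by auto
    then show "dist (f (t + h) + g (t + h)) (f (t + k) + g (t + k)) < e"
      using dist_triangle_add[of "f (t + h)" "g (t + h)" "f (t + k)" "g (t + k)"] by linarith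
  qed
qed

lemma translation_precompact_uniform_closure:
  assumes "\<And>e. e > 0 \<Longrightarrow> \<exists>g. translation_precompact g \<and> (\<forall>t. dist (f t) (g t) < e)"
  shows "translation_precompact f"
  unfolding translation_precompact_def
proof (intro allI impI)
  fix T e :: real assume "e > 0"
  then have e: "e / 3 > 0" by simp
  from assms[OF this] obtain g where g: "translation_precompact g" "\<And>t. dist (f t) (g t) < e / 3"
    by blast
  show "finite_colouring (\<lambda>h k. \<forall>t\<in>{-T..T}. dist (f (t + h)) (f (t + k)) < e)"
  proof (rule finite_colouring_mono[OF translation_precompactD[OF g(1) e, of T]], intro ballI)
    fix h k t assume "\<forall>t\<in>{-T..T}. dist (g (t + h)) (g (t + k)) < e / 3" "t \<in> {-T..T}"
    then have "dist (g (t + h)) (g (t + k)) < e / 3" by blast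
    with g(2)[of "t + h"] g(2)[of "t + k"] show "dist (f (t + h)) (f (t + k)) < e"
      using dist_triangle[of "f (t + h)" "f (t + k)" "g (t + h)"]
        dist_triangle[of "g (t + h)" "f (t + k)" "g (t + k)"] dist_commute[of "g (t + k)" "f (t + k)"]
      by linarith
  qed
qed

text \<open>The colouring of \<open>H\<close> compares two times at the same state in
  \<open>K\<close>, hence \<open>\<phi>\<close> must stay in \<open>K\<close>; the Lipschitz
  estimate handles the change of state at a fixed time.\<close>

lemma translation_precompact_superposition:
  fixes H :: "real \<times> 'a::metric_space \<Rightarrow> 'b::metric_space"
  assumes \<phi>: "translation_precompact \<phi>" and K: "\<And>t. \<phi> t \<in> K"
    and lip: "\<And>t x y. dist (H (t, x)) (H (t, y)) \<le> l * dist x y"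
    and H: "\<And>T e. e > 0 \<Longrightarrow>
      finite_colouring (\<lambda>h k. \<forall>t\<in>{-T..T}. \<forall>x\<in>K. dist (H (t + h, x)) (H (t + k, x)) < e)"
  shows "translation_precompact (\<lambda>t. H (t, \<phi> t))"
  unfolding translation_precompact_def
proof (intro allI impI)
  fix T e :: real assume e: "e > 0"
  \<comment> \<open>The added 1 avoids division by zero when \<open>l = 0\<close>.\<close>
  define d where "d = e / (2 * (\<bar>l\<bar> + 1))"
  have d: "d > 0" "\<bar>l\<bar> * d \<le> e / 2" using e by (auto simp: d_def divide_simps)
  have e2: "e / 2 > 0" using e by simp
  show "finite_colouring (\<lambda>h k. \<forall>t\<in>{-T..T}. dist (H (t + h, \<phi> (t + h))) (H (t + k, \<phi> (t + k))) < e)"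
  proof (rule finite_colouring_mono[OF finite_colouring_conj[OF
          translation_precompactD[OF \<phi> d(1), of T] H[OF e2, of T]]], intro ballI)
    fix h k t assume *: "(\<forall>t\<in>{-T..T}. dist (\<phi> (t + h)) (\<phi> (t + k)) < d) \<and>
      (\<forall>t\<in>{-T..T}. \<forall>x\<in>K. dist (H (t + h, x)) (H (t + k, x)) < e / 2)" and t: "t \<in> {-T..T}"
    have "dist (H (t + h, \<phi> (t + h))) (H (t + h, \<phi> (t + k))) \<le> l * dist (\<phi> (t + h)) (\<phi> (t + k))"
      by (rule lip)
    also have "\<dots> \<le> \<bar>l\<bar> * dist (\<phi> (t + h)) (\<phi> (t + k))" by (intro mult_right_mono) auto
    also have "\<dots> \<le> \<bar>l\<bar> * d" using * t by (intro mult_left_mono) (auto intro: less_imp_le)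
    finally have "dist (H (t + h, \<phi> (t + h))) (H (t + h, \<phi> (t + k))) \<le> e / 2" using d(2) by simp
    moreover have "dist (H (t + h, \<phi> (t + k))) (H (t + k, \<phi> (t + k))) < e / 2" using * t K by blast
    ultimately show "dist (H (t + h, \<phi> (t + h))) (H (t + k, \<phi> (t + k))) < e"
      using dist_triangle[of "H (t + h, \<phi> (t + h))" "H (t + k, \<phi> (t + k))" "H (t + h, \<phi> (t + k))"]
      by linarith
  qed
qed

section \<open>Convergence of translates as a Cauchy condition\<close>

lemma limitin_compact_open_imp_uniformly_Cauchy_on:
  fixes g :: "nat \<Rightarrow> 's::t2_space \<Rightarrow> 'e::metric_space"
  assumes "limitin (compact_open S) g l sequentially" "compact K" "K \<subseteq> S"
  shows "uniformly_Cauchy_on K g"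
  by (rule uniformly_convergent_Cauchy)
    (use assms in \<open>auto simp: limitin_compact_open uniformly_convergent_on_def\<close>)

lemma uniformly_Cauchy_on_imp_limitin_compact_open:
  fixes g :: "nat \<Rightarrow> real \<Rightarrow> 'e::complete_space"
  assumes cont: "\<And>n. continuous_on UNIV (g n)"
    and cauchy: "\<And>T. uniformly_Cauchy_on {-T..T} g"
  shows "\<exists>l. limitin (compact_open UNIV) g l sequentially"
proof -
  define l where "l t = lim (\<lambda>n. g n t)" for t
  have unif: "uniform_limit {-T..T} g l sequentially" for T
  proof -
    have "uniformly_convergent_on {-T..T} g" by (rule Cauchy_uniformly_convergent[OF cauchy])
    then show ?thesis unfolding l_def by (simp add: uniformly_convergent_uniform_limit_iff)
  qed
  have "isCont l t" for t
  proof -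
    have "continuous_on {-(\<bar>t\<bar> + 1)..\<bar>t\<bar> + 1} l"
      by (rule uniform_limit_theorem[OF _ unif])
        (auto intro!: always_eventually continuous_on_subset[OF cont])
    then show ?thesis by (rule continuous_on_interior) auto
  qed
  then have "continuous_on UNIV l" by (simp add: continuous_at_imp_continuous_on)
  moreover have "uniform_limit K g l sequentially" if "compact K" for K
  proof -
    obtain T where T: "\<And>x. x \<in> K \<Longrightarrow> norm x \<le> T"
      using compact_imp_bounded[OF \<open>compact K\<close>] unfolding bounded_iff by blast
    have "x \<in> {-T..T}" if "x \<in> K" for x using T[OF that] by (simp add: abs_le_iff)
    then have "K \<subseteq> {-T..T}" by blast
    then show ?thesis by (rule uniform_limit_on_subset[OF unif])
  qed
  ultimately have "limitin (compact_open UNIV) g l sequentially"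
    using cont by (simp add: limitin_compact_open cont_funs_def)
  then show ?thesis by (rule exI[where x = l])
qed

section \<open>Translates of bounded solutions\<close>

context dichotomy
begin

text \<open>
  The difference of two translates solves the linear equation with a forcing term that is small
  on a long interval and merely bounded elsewhere; the weight absorbs the latter part. The
  limiting equations are never considered.
\<close>

lemma translates_close:
  assumes \<phi>: "\<And>t. (\<phi> has_vector_derivative A t (\<phi> t) + (f t + H (t, \<phi> t))) (at t)"
    and B: "\<And>t. norm (\<phi> t) \<le> B" and K: "\<And>t. \<phi> t \<in> K"
    and M: "\<And>t. norm (A t) \<le> M" and m: "\<And>t. norm (f t) \<le> m"
    and H: "\<And>t x y. norm (H (t, x) - H (t, y)) \<le> l * norm (x - y)" "\<And>t. H (t, 0) = 0"
    and l: "l \<ge> 0" "\<kappa> * l \<le> 1/4" and e: "e > 0"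
  obtains T' \<delta> where "\<delta> > 0" and
    "\<And>h k t. (\<forall>s\<in>{-T'..T'}. dist (A (s + h)) (A (s + k)) < \<delta>) \<Longrightarrow>
       (\<forall>s\<in>{-T'..T'}. dist (f (s + h)) (f (s + k)) < \<delta>) \<Longrightarrow>
       (\<forall>s\<in>{-T'..T'}. \<forall>x\<in>K. dist (H (s + h, x)) (H (s + k, x)) < \<delta>) \<Longrightarrow>
       t \<in> {-T..T} \<Longrightarrow> dist (\<phi> (t + h)) (\<phi> (t + k)) < e"
proof -
  have B0: "B \<ge> 0" using B[of 0] norm_ge_zero[of "\<phi> 0"] by linarith
  \<comment> \<open>Solves \<open>2 * \<kappa> * \<eta> * exp (\<nu> / 2 * T) = e / 2\<close>, the
    final estimate at distance at most \<open>T\<close> from the centre of the weight.\<close>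
  define \<eta> where "\<eta> = e * exp (- (\<nu> / 2 * T)) / (4 * \<kappa>)"
  have \<eta>: "\<eta> > 0" using e \<kappa>_pos by (simp add: \<eta>_def)
  \<comment> \<open>Near the centre \<open>A\<close> contributes \<open>\<delta> * B\<close>, and
    \<open>f\<close> and \<open>H\<close> contribute \<open>\<delta>\<close> each; together this is
    \<open>\<eta>\<close>.\<close>
  define \<delta> where "\<delta> = \<eta> / (B + 2)"
  have "\<delta> * (B + 2) = \<eta>" using B0 by (simp add: \<delta>_def)
  then have \<delta>: "\<delta> > 0" "\<delta> * B + \<delta> + \<delta> = \<eta>"
    using \<eta> B0 by (simp add: \<delta>_def, simp add: algebra_simps)
  \<comment> \<open>Crude bound for the same three contributions at any time; \<open>T'\<close> is
    taken so large that \<open>\<eta>\<close> times the weight at distance \<open>T'\<close> already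
    dominates it.\<close>
  define D where "D = 2 * M * B + 2 * m + 2 * l * B"
  have "((\<lambda>r. D * exp (- (\<nu> / 2 * r))) \<longlongrightarrow> 0) at_top" using \<nu> by real_asymp
  then have "\<forall>\<^sub>F r in at_top. D * exp (- (\<nu> / 2 * r)) < \<eta>"
    using \<eta> by (rule order_tendstoD)
  from eventually_happens'[OF trivial_limit_at_top_linorder this]
  obtain T' where "D * exp (- (\<nu> / 2 * T')) < \<eta>" ..
  then have T': "D \<le> \<eta> * exp (\<nu> / 2 * T')" by (simp add: exp_minus divide_simps)
  show thesis
  proof (rule that[OF \<delta>(1)])
    fix h k t
    assume dA: "\<forall>s\<in>{-T'..T'}. dist (A (s + h)) (A (s + k)) < \<delta>"
      and df: "\<forall>s\<in>{-T'..T'}. dist (f (s + h)) (f (s + k)) < \<delta>"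
      and dH: "\<forall>s\<in>{-T'..T'}. \<forall>x\<in>K. dist (H (s + h, x)) (H (s + k, x)) < \<delta>"
      and t: "t \<in> {-T..T}"
    \<comment> \<open>With this shift \<open>?v (t + h)\<close> is the wanted difference at
      \<open>t\<close>, and the assumptions on \<open>{-T'..T'}\<close> concern the times
      \<open>s\<close> with \<open>\<bar>s - h\<bar> \<le> T'\<close>.\<close>
    let ?s = "\<lambda>s. s + (k - h)"
    let ?v = "\<lambda>s. \<phi> s - \<phi> (?s s)"
    \<comment> \<open>The change of state in \<open>H\<close> at time \<open>s\<close> is at most
      \<open>l * norm (?v s)\<close> and gets absorbed; every other term compares data at two
      times.\<close>
    let ?f = "\<lambda>s. (A s - A (?s s)) (\<phi> (?s s)) + (f s - f (?s s))
      + ((H (s, \<phi> s) - H (s, \<phi> (?s s))) + (H (s, \<phi> (?s s)) - H (?s s, \<phi> (?s s))))"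
    have v: "(?v has_vector_derivative A s (?v s) + ?f s) (at s)" for s
    proof -
      have "(?v has_vector_derivative (A s (\<phi> s) + (f s + H (s, \<phi> s)))
          - (A (?s s) (\<phi> (?s s)) + (f (?s s) + H (?s s, \<phi> (?s s))))) (at s)"
        by (intro has_vector_derivative_diff has_vector_derivative_translate \<phi>)
      moreover have "(A s (\<phi> s) + (f s + H (s, \<phi> s)))
          - (A (?s s) (\<phi> (?s s)) + (f (?s s) + H (?s s, \<phi> (?s s)))) = A s (?v s) + ?f s"
        by (simp add: blinfun.bilinear_simps algebra_simps)
      ultimately show ?thesis by simp
    qed
    have f_bd: "norm (?f s) \<le> \<eta> * exp (\<nu> / 2 * \<bar>s - h\<bar>) + l * norm (?v s)" for s
    proof -
      have eq: "s - h + h = s" "s - h + k = ?s s" by simp_all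
      let ?g1 = "(A s - A (?s s)) (\<phi> (?s s))" and ?g2 = "f s - f (?s s)"
        and ?g3 = "H (s, \<phi> (?s s)) - H (?s s, \<phi> (?s s))"
      have AB: "norm ?g1 \<le> norm (A s - A (?s s)) * B"
        by (intro order.trans[OF norm_blinfun] mult_left_mono B) simp
      have "norm ?g1 + norm ?g2 + norm ?g3 \<le> \<eta> * exp (\<nu> / 2 * \<bar>s - h\<bar>)"
      proof (cases "\<bar>s - h\<bar> \<le> T'")
        case True
        then have "s - h \<in> {-T'..T'}" by auto
        from dA[rule_format, OF this] df[rule_format, OF this] dH[rule_format, OF this K[of "?s s"]]
        have "norm (A s - A (?s s)) \<le> \<delta>" "norm ?g2 \<le> \<delta>" "norm ?g3 \<le> \<delta>"
          unfolding eq dist_norm by (simp_all only: less_imp_le)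
        moreover from this(1) have "norm ?g1 \<le> \<delta> * B"
          using AB mult_right_mono[OF _ B0] by (meson order.trans)
        ultimately have "norm ?g1 + norm ?g2 + norm ?g3 \<le> \<eta> * 1" using \<delta>(2) by simp
        also have "\<dots> \<le> \<eta> * exp (\<nu> / 2 * \<bar>s - h\<bar>)" using \<eta> \<nu> by (intro mult_left_mono) auto
        finally show ?thesis .
      next
        case False
        have "norm (A s - A (?s s)) \<le> M + M"
          by (rule order.trans[OF norm_triangle_ineq4 add_mono[OF M M]])
        then have "norm (A s - A (?s s)) * B \<le> (M + M) * B" by (rule mult_right_mono[OF _ B0])
        with AB have "norm ?g1 \<le> (M + M) * B" by (rule order.trans)
        moreover have "norm ?g2 \<le> m + m"
          by (rule order.trans[OF norm_triangle_ineq4 add_mono[OF m m]])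
        moreover have Hl: "norm (H (r, \<phi> (?s s))) \<le> l * B" for r
          using H(1)[of r "\<phi> (?s s)" 0] mult_left_mono[OF B[of "?s s"] l(1)] by (simp add: H(2))
        have "norm ?g3 \<le> l * B + l * B"
          by (rule order.trans[OF norm_triangle_ineq4 add_mono[OF Hl Hl]])
        ultimately have "norm ?g1 + norm ?g2 + norm ?g3 \<le> D" by (simp add: D_def algebra_simps)
        also have "\<dots> \<le> \<eta> * exp (\<nu> / 2 * T')" by (rule T')
        also have "\<dots> \<le> \<eta> * exp (\<nu> / 2 * \<bar>s - h\<bar>)" using \<eta> \<nu> False by (intro mult_left_mono) auto
        finally show ?thesis .
      qed
      moreover have "norm (?f s) \<le> norm ?g1 + norm ?g2 + (norm (H (s, \<phi> s) - H (s, \<phi> (?s s))) + norm ?g3)"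
        by (intro norm_triangle_mono order_refl)
      ultimately show ?thesis using H(1)[of s "\<phi> s" "\<phi> (?s s)"] by linarith
    qed
    have "norm (?v s) \<le> B + B" for s
      by (rule order.trans[OF norm_triangle_ineq4 add_mono[OF B B]])
    from perturbed_weighted_bound[OF v this _ l f_bd, of "t + h"] \<eta>
    have "norm (?v (t + h)) \<le> 2 * \<kappa> * \<eta> * exp (\<nu> / 2 * \<bar>t\<bar>)" by simp
    also have "\<dots> \<le> 2 * \<kappa> * \<eta> * exp (\<nu> / 2 * T)"
      using t \<nu> \<eta> \<kappa>_pos by (intro mult_left_mono) auto
    also have "\<dots> = e / 2" using \<kappa>_pos by (simp add: \<eta>_def exp_minus)
    finally show "dist (\<phi> (t + h)) (\<phi> (t + k)) < e"
      using e by (simp add: dist_norm algebra_simps)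
  qed
qed

text \<open>The case of zero nonlinearity in \<open>translates_close\<close>, where \<open>K\<close>
  may be the whole space: a common colour for \<open>A\<close> and \<open>g\<close> is a colour for
  \<open>w\<close>.\<close>

lemma bounded_solution_translation_precompact:
  assumes w: "\<And>t. (w has_vector_derivative A t (w t) + g t) (at t)"
    and B: "\<And>t. norm (w t) \<le> B"
    and A: "translation_precompact A" and g: "translation_precompact g"
  shows "translation_precompact w"
  unfolding translation_precompact_def
proof (intro allI impI)
  fix T e :: real assume e: "e > 0"
  obtain M where M: "\<And>t. norm (A t) \<le> M" using translation_precompact_bounded[OF A] by blast
  obtain m where m: "\<And>t. norm (g t) \<le> m" using translation_precompact_bounded[OF g] by blast
  have "(w has_vector_derivative A t (w t) + (g t + (\<lambda>_. 0) (t, w t))) (at t)" for t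
    using w by simp
  then obtain T' \<delta> where \<delta>: "\<delta> > 0" and
    close: "\<And>h k t. (\<forall>s\<in>{-T'..T'}. dist (A (s + h)) (A (s + k)) < \<delta>) \<Longrightarrow>
       (\<forall>s\<in>{-T'..T'}. dist (g (s + h)) (g (s + k)) < \<delta>) \<Longrightarrow>
       (\<forall>s\<in>{-T'..T'}. \<forall>x\<in>UNIV::'a set. dist ((\<lambda>_. 0 :: 'a) (s + h, x)) ((\<lambda>_. 0) (s + k, x)) < \<delta>) \<Longrightarrow>
       t \<in> {-T..T} \<Longrightarrow> dist (w (t + h)) (w (t + k)) < e"
    by (rule translates_close[where T = T and K = UNIV and l = 0, OF _ B _ M m _ _ _ _ e]) auto
  show "finite_colouring (\<lambda>h k. \<forall>t\<in>{-T..T}. dist (w (t + h)) (w (t + k)) < e)"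
    by (rule finite_colouring_mono[OF finite_colouring_conj[OF
          translation_precompactD[OF A \<delta>, of T'] translation_precompactD[OF g \<delta>, of T']]])
      (use close \<delta> in auto)
qed

text \<open>\<open>\<Gamma>\<close> solves the linear equation with the nonlinearity frozen along
  \<open>\<phi>\<close>. It preserves precompactness of translates, because \<open>HK\<close>
  applies to the compact closure of the range of \<open>\<phi>\<close>, and contracts with factor
  \<open>\<kappa> * l\<close>.\<close>

lemma semilinear_bounded_solution_exists:
  assumes A: "translation_precompact A"
    and f: "continuous_on UNIV f" "translation_precompact f"
    and H_cont: "continuous_on UNIV H"
    and H: "\<And>t x y. norm (H (t, x) - H (t, y)) \<le> l * norm (x - y)" "\<And>t. H (t, 0) = 0"
    and l: "l \<ge> 0" "\<kappa> * l \<le> 1/4"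
    and HK: "\<And>K T e. compact K \<Longrightarrow> e > 0 \<Longrightarrow>
      finite_colouring (\<lambda>h k. \<forall>t\<in>{-T..T}. \<forall>x\<in>K. dist (H (t + h, x)) (H (t + k, x)) < e)"
  obtains \<phi> where "\<phi> \<in> bcontfun" "translation_precompact \<phi>"
    "\<And>t. (\<phi> has_vector_derivative A t (\<phi> t) + (f t + H (t, \<phi> t))) (at t)"
proof -
  obtain m where m: "\<And>t. norm (f t) \<le> m" using translation_precompact_bounded[OF f(2)] by blast
  have "\<exists>\<psi> :: real \<Rightarrow>\<^sub>C 'a. \<forall>t. (\<psi> has_vector_derivative A t (\<psi> t) + (f t + H (t, \<phi> t))) (at t)"
    for \<phi> :: "real \<Rightarrow>\<^sub>C 'a"
  proof -
    have "norm (H (t, \<phi> t)) \<le> l * norm \<phi>" for t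
      using H(1)[of t "\<phi> t" 0] mult_left_mono[OF norm_bounded[of \<phi> t] l(1)] by (simp add: H(2))
    then have bd: "norm (f t + H (t, \<phi> t)) \<le> m + l * norm \<phi>" for t
      by (intro norm_triangle_mono m)
    have "continuous_on UNIV (\<lambda>t. f t + H (t, \<phi> t))"
      by (intro continuous_intros f continuous_on_compose2[OF H_cont] continuous_on_apply_bcontfun) auto
    from bounded_solution_exists[OF this bd] obtain w
      where w: "\<And>t. (w has_vector_derivative A t (w t) + (f t + H (t, \<phi> t))) (at t)"
        and b: "\<And>t. norm (w t) \<le> \<kappa> * (m + l * norm \<phi>)" by blast
    have "w \<in> bcontfun"
      by (rule bcontfun_normI[OF continuous_on_UNIV_has_vector_derivative[OF w] b])
    then obtain \<psi> where "w = apply_bcontfun \<psi>" by (rule bcontfunE)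
    then show ?thesis using w by blast
  qed
  then obtain \<Gamma> :: "(real \<Rightarrow>\<^sub>C 'a) \<Rightarrow> (real \<Rightarrow>\<^sub>C 'a)" where
    \<Gamma>: "\<And>\<phi> t. (\<Gamma> \<phi> has_vector_derivative A t (\<Gamma> \<phi> t) + (f t + H (t, \<phi> t))) (at t)"
    using choice[of "\<lambda>\<phi> \<psi>. \<forall>t. (apply_bcontfun \<psi> has_vector_derivative
      A t (\<psi> t) + (f t + H (t, apply_bcontfun \<phi> t))) (at t)"] by blast
  let ?S = "{\<phi> :: real \<Rightarrow>\<^sub>C 'a. translation_precompact \<phi>}"
  have "\<exists>!\<phi>\<in>?S. \<Gamma> \<phi> = \<phi>"
  proof (rule Banach_fix[where c = "1/4"])
    have "\<phi> \<in> ?S" if "\<phi> \<in> closure ?S" for \<phi>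
    proof -
      have "\<exists>g. translation_precompact g \<and> (\<forall>t. dist (\<phi> t) (g t) < e)" if "e > 0" for e
      proof -
        obtain \<psi> where "\<psi> \<in> ?S" "dist \<psi> \<phi> < e"
          using \<open>\<phi> \<in> closure ?S\<close> \<open>e > 0\<close> unfolding closure_approachable by blast
        then show ?thesis
          using dist_fun_lt_imp_dist_val_lt[of \<phi> \<psi> e] by (auto simp: dist_commute)
      qed
      then show ?thesis by (auto intro: translation_precompact_uniform_closure)
    qed
    then have "closed ?S" by (simp only: closure_subset_eq[symmetric] subsetI)
    then show "complete ?S" by (simp add: complete_eq_closed)
    have "(0 :: real \<Rightarrow>\<^sub>C 'a) \<in> ?S"
      using translation_precompact_const[of "0 :: 'a"] by simp
    then show "?S \<noteq> {}" by blast
    show "\<Gamma> ` ?S \<subseteq> ?S"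
    proof clarify
      fix \<phi> :: "real \<Rightarrow>\<^sub>C 'a" assume \<phi>: "translation_precompact \<phi>"
      have "translation_precompact (\<lambda>t. H (t, \<phi> t))"
      proof (rule translation_precompact_superposition[OF \<phi>, of "closure (range \<phi>)"])
        show "dist (H (t, x)) (H (t, y)) \<le> l * dist x y" for t x y
          using H(1) by (simp add: dist_norm)
        show "\<phi> t \<in> closure (range \<phi>)" for t by (rule subsetD[OF closure_subset rangeI])
        show "finite_colouring (\<lambda>h k. \<forall>t\<in>{-T..T}. \<forall>x\<in>closure (range \<phi>).
            dist (H (t + h, x)) (H (t + k, x)) < e)" if "e > 0" for T e
          by (rule HK[OF translation_precompact_compact_range[OF \<phi>] that])
      qed
      from translation_precompact_add[OF f(2) this] show "translation_precompact (\<Gamma> \<phi>)"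
        by (rule bounded_solution_translation_precompact[OF \<Gamma> norm_bounded A])
    qed
    show "dist (\<Gamma> \<phi>) (\<Gamma> \<psi>) \<le> 1/4 * dist \<phi> \<psi>" for \<phi> \<psi>
    proof (rule dist_bound)
      fix t
      let ?w = "\<lambda>t. \<Gamma> \<phi> t - \<Gamma> \<psi> t" and ?g = "\<lambda>t. H (t, \<phi> t) - H (t, \<psi> t)"
      have w: "(?w has_vector_derivative A s (?w s) + ?g s) (at s)" for s
        using has_vector_derivative_diff[OF \<Gamma>[of \<phi> s] \<Gamma>[of \<psi> s]]
        by (simp add: blinfun.bilinear_simps algebra_simps)
      have b: "norm (?w s) \<le> norm (\<Gamma> \<phi> - \<Gamma> \<psi>)" for s
        using norm_bounded[of "\<Gamma> \<phi> - \<Gamma> \<psi>" s] by simp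
      have g: "norm (?g s) \<le> (l * dist \<phi> \<psi>) * exp (\<nu> / 2 * \<bar>s - t\<bar>)" for s
      proof -
        have "norm (?g s) \<le> l * norm (\<phi> s - \<psi> s)" by (rule H(1))
        also have "\<dots> \<le> l * dist \<phi> \<psi> * 1"
          using l(1) norm_bounded[of "\<phi> - \<psi>" s] by (auto simp: dist_norm intro: mult_left_mono)
        also have "\<dots> \<le> (l * dist \<phi> \<psi>) * exp (\<nu> / 2 * \<bar>s - t\<bar>)"
          using l(1) \<nu> by (intro mult_left_mono) auto
        finally show ?thesis .
      qed
      \<comment> \<open>The weight is centred at the evaluation point, where it equals 1.\<close>
      have "norm (?w t) \<le> \<kappa> * (l * dist \<phi> \<psi>) * exp (\<nu> / 2 * \<bar>t - t\<bar>)"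
        by (rule weighted_bound[OF w b _ g]) (use l(1) in simp)
      also have "\<dots> = (\<kappa> * l) * dist \<phi> \<psi>" by simp
      also have "\<dots> \<le> 1/4 * dist \<phi> \<psi>" by (intro mult_right_mono l(2)) simp
      finally show "dist (\<Gamma> \<phi> t) (\<Gamma> \<psi> t) \<le> 1/4 * dist \<phi> \<psi>" by (simp add: dist_norm)
    qed
  qed simp_all
  then obtain \<phi> :: "real \<Rightarrow>\<^sub>C 'a" where \<phi>: "translation_precompact \<phi>" "\<Gamma> \<phi> = \<phi>" by blast
  show thesis
    by (rule that[OF apply_bcontfun \<phi>(1) \<Gamma>[of \<phi>, unfolded \<phi>(2)]])
qed

text \<open>Convergent translates of the data are uniformly Cauchy on compact sets, and
  \<open>translates_close\<close> carries this over to \<open>\<phi>\<close>; completeness of the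
  space then provides the limit.\<close>

lemma bounded_solution_remotely_compatible:
  assumes \<phi>: "\<And>t. (\<phi> has_vector_derivative A t (\<phi> t) + (f t + H (t, \<phi> t))) (at t)"
    and comp: "translation_precompact \<phi>"
    and M: "\<And>t. norm (A t) \<le> M" and m: "\<And>t. norm (f t) \<le> m"
    and H: "\<And>t x y. norm (H (t, x) - H (t, y)) \<le> l * norm (x - y)" "\<And>t. H (t, 0) = 0"
    and l: "l \<ge> 0" "\<kappa> * l \<le> 1/4"
  shows "remotely_compatible A f H \<phi>"
proof -
  let ?K = "closure (range \<phi>)"
  let ?H = "restrict H (UNIV \<times> ?K)"
  have K: "compact ?K" by (rule translation_precompact_compact_range[OF comp])
  obtain B where B: "\<And>t. norm (\<phi> t) \<le> B" using translation_precompact_bounded[OF comp] by blast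
  have \<phi>K: "\<phi> t \<in> ?K" for t by (rule subsetD[OF closure_subset rangeI])
  have "\<exists>l. limitin (compact_open UNIV) (\<lambda>n. shift (s n) \<phi>) l sequentially"
    if lim: "limitin (prod_topology (compact_open UNIV)
            (prod_topology (compact_open UNIV) (compact_open (UNIV \<times> ?K))))
          (\<lambda>n. (shift (s n) A, shift (s n) f, shift2 (s n) ?H)) L sequentially" for s :: "nat \<Rightarrow> real" and L
  proof (rule uniformly_Cauchy_on_imp_limitin_compact_open)
    show "continuous_on UNIV (shift (s n) \<phi>)" for n
      unfolding shift_def
      by (rule continuous_on_compose2[OF continuous_on_UNIV_has_vector_derivative[OF \<phi>, of UNIV]])
        (auto intro!: continuous_intros)
    have limA: "limitin (compact_open UNIV) (\<lambda>n. shift (s n) A) (fst L) sequentially"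
      and limf: "limitin (compact_open UNIV) (\<lambda>n. shift (s n) f) (fst (snd L)) sequentially"
      and limH: "limitin (compact_open (UNIV \<times> ?K)) (\<lambda>n. shift2 (s n) ?H) (snd (snd L)) sequentially"
      using lim unfolding limitin_pairwise by (simp_all add: o_def)
    fix T :: real
    show "uniformly_Cauchy_on {-T..T} (\<lambda>n. shift (s n) \<phi>)"
      unfolding uniformly_Cauchy_on_def
    proof (intro allI impI)
      fix e :: real assume e: "e > 0"
      obtain T' \<delta> where \<delta>: "\<delta> > 0" and
        close: "\<And>h k t. (\<forall>s\<in>{-T'..T'}. dist (A (s + h)) (A (s + k)) < \<delta>) \<Longrightarrow>
           (\<forall>s\<in>{-T'..T'}. dist (f (s + h)) (f (s + k)) < \<delta>) \<Longrightarrow>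
           (\<forall>s\<in>{-T'..T'}. \<forall>x\<in>?K. dist (H (s + h, x)) (H (s + k, x)) < \<delta>) \<Longrightarrow>
           t \<in> {-T..T} \<Longrightarrow> dist (\<phi> (t + h)) (\<phi> (t + k)) < e"
        by (rule translates_close[where T = T, OF \<phi> B \<phi>K M m H l e]) (rule that)
      obtain Na where
        Na: "\<forall>t\<in>{-T'..T'}. \<forall>i\<ge>Na. \<forall>j\<ge>Na. dist (shift (s i) A t) (shift (s j) A t) < \<delta>"
        using limitin_compact_open_imp_uniformly_Cauchy_on[OF limA, of "{-T'..T'}"] \<delta>
        unfolding uniformly_Cauchy_on_def by auto
      obtain Nf where
        Nf: "\<forall>t\<in>{-T'..T'}. \<forall>i\<ge>Nf. \<forall>j\<ge>Nf. dist (shift (s i) f t) (shift (s j) f t) < \<delta>"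
        using limitin_compact_open_imp_uniformly_Cauchy_on[OF limf, of "{-T'..T'}"] \<delta>
        unfolding uniformly_Cauchy_on_def by auto
      \<comment> \<open>Compactness of \<open>?K\<close> makes this product compact, so compact-open
        convergence is uniform on it.\<close>
      have "uniformly_Cauchy_on ({-T'..T'} \<times> ?K) (\<lambda>n. shift2 (s n) ?H)"
        by (rule limitin_compact_open_imp_uniformly_Cauchy_on[OF limH compact_Times[OF _ K]]) auto
      from this[unfolded uniformly_Cauchy_on_def, rule_format, OF \<delta>] obtain Nh where
        Nh: "\<forall>p\<in>{-T'..T'} \<times> ?K. \<forall>i\<ge>Nh. \<forall>j\<ge>Nh. dist (shift2 (s i) ?H p) (shift2 (s j) ?H p) < \<delta>"
        by blast
      show "\<exists>M. \<forall>t\<in>{-T..T}. \<forall>i\<ge>M. \<forall>j\<ge>M. dist (shift (s i) \<phi> t) (shift (s j) \<phi> t) < e"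
      proof (intro exI ballI allI impI)
        fix t i j assume t: "t \<in> {-T..T}" and ij: "i \<ge> max Na (max Nf Nh)" "j \<ge> max Na (max Nf Nh)"
        have "dist (H (r + s i, x)) (H (r + s j, x)) < \<delta>" if "r \<in> {-T'..T'}" "x \<in> ?K" for r x
          using Nh[rule_format, of "(r, x)" i j] that ij by (simp add: shift2_def)
        then show "dist (shift (s i) \<phi> t) (shift (s j) \<phi> t) < e"
          using Na Nf ij unfolding shift_def by (intro close t) auto
      qed
    qed
  qed
  then have "translate_seqs (prod_topology (compact_open UNIV)
        (prod_topology (compact_open UNIV) (compact_open (UNIV \<times> ?K))))
        (\<lambda>h. (shift h A, shift h f, shift2 h ?H))
      \<subseteq> translate_seqs (compact_open UNIV) (\<lambda>h. shift h \<phi>)"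
    unfolding translate_seqs_def by blast
  moreover have "is_solution A f H \<phi>"
    using \<phi> unfolding is_solution_def by (simp add: add.assoc)
  ultimately show ?thesis
    using K unfolding remotely_compatible_def Let_def by (intro conjI)
qed

end

section \<open>Small perturbations\<close>

lemma (in normed_space_over) bounded_linear_smul: "bounded_linear (smul c)"
proof
  show "smul c (x + y) = smul c x + smul c y" for x y by (rule scale_right_distrib)
  show "smul c (r *\<^sub>R x) = r *\<^sub>R smul c x" for r x
    by (simp flip: smul_of_real add: mult.commute)
  show "\<exists>K. \<forall>x. norm (smul c x) \<le> norm x * K"
    by (intro exI[of _ "norm c"]) (simp add: norm_smul mult.commute)
qed

theorem theorem6p23:
  fixes smul :: "'k::real_normed_field \<Rightarrow> 'a::banach \<Rightarrow> 'a"
    and A :: "real \<Rightarrow> 'a \<Rightarrow>\<^sub>L 'a"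
    and f :: "real \<Rightarrow> 'a"
    and F :: "real \<times> 'a \<Rightarrow> 'a"
    and P :: "'a \<Rightarrow>\<^sub>L 'a"
    and L :: real
  assumes "normed_space_over smul"
    and "range A \<subseteq> operators_over smul" and "continuous_on UNIV A"
    and "continuous_on UNIV f"
    and "continuous_on UNIV F" and "\<And>t. F (t, 0) = 0"
    and "P \<in> operators_over smul" and "exp_dichotomy A P"
    and "precompact_in euclidean
           (range (\<lambda>t. cauchy_op A t o\<^sub>L P o\<^sub>L blinfun_inv (cauchy_op A t)))"
    and "lagrange_stable (compact_open UNIV) (\<lambda>h. shift h A)"
    and "lagrange_stable (compact_open UNIV) (\<lambda>h. shift h f)"
    and "lagrange_stable (compact_open UNIV) (\<lambda>h. shift2 h F)"
    and "L > 0"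
    and "\<And>t u\<^sub>1 u\<^sub>2. norm (F (t, u\<^sub>1) - F (t, u\<^sub>2)) \<le> L * norm (u\<^sub>1 - u\<^sub>2)"
  shows "\<exists>\<epsilon>\<^sub>0 > 0. \<exists>\<phi> :: 'k \<Rightarrow> real \<Rightarrow> 'a.
    (\<forall>\<epsilon>. norm \<epsilon> \<le> \<epsilon>\<^sub>0 \<longrightarrow>
       \<phi> \<epsilon> \<in> bcontfun \<and>
       remotely_compatible A f (\<lambda>p. smul \<epsilon> (F p)) (\<phi> \<epsilon>) \<and>
       (\<forall>t. ((\<lambda>\<tau>. green A P t \<tau> (f \<tau> + smul \<epsilon> (F (\<tau>, \<phi> \<epsilon> \<tau>)))) has_integral \<phi> \<epsilon> t) UNIV)) \<and>
    remotely_compatible A f (\<lambda>_. 0) (\<phi> 0) \<and>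
    (\<forall>t. ((\<lambda>\<tau>. green A P t \<tau> (f \<tau>)) has_integral \<phi> 0 t) UNIV) \<and>
    uniform_limit UNIV \<phi> (\<phi> 0) (at 0)"
proof -
  interpret smul: normed_space_over smul by (rule assms(1))
  interpret smul_lin: bounded_linear "smul c" for c by (rule smul.bounded_linear_smul)
  have A: "translation_precompact A" and f: "translation_precompact f"
    using assms(10,11) by (auto intro: lagrange_stable_imp_translation_precompact)
  obtain M where M: "\<And>t. norm (A t) \<le> M" using translation_precompact_bounded[OF A] by blast
  obtain m where m: "\<And>t. norm (f t) \<le> m" using translation_precompact_bounded[OF f] by blast
  obtain U V where U: "U 0 = id_blinfun" "\<And>t. (U has_vector_derivative A t o\<^sub>L U t) (at t)"
    and V: "\<And>t. (V has_vector_derivative - (V t o\<^sub>L A t)) (at t)"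
    and UV: "\<And>t. U t o\<^sub>L V t = id_blinfun" and VU: "\<And>t. V t o\<^sub>L U t = id_blinfun"
    using fundamental_solution[OF assms(3) M] by blast
  have cU: "cauchy_op A = U" by (rule cauchy_op_eqI[OF M U])
  have iU: "blinfun_inv (U t) = V t" for t by (rule blinfun_inv_eqI[OF VU UV])
  obtain N \<nu> where "N \<ge> 1" "\<nu> > 0"
    and "\<And>t \<tau>. t > \<tau> \<Longrightarrow> norm (U t o\<^sub>L P o\<^sub>L V \<tau>) \<le> N * exp (- \<nu> * (t - \<tau>))"
    and "\<And>t \<tau>. t < \<tau> \<Longrightarrow> norm (U t o\<^sub>L (id_blinfun - P) o\<^sub>L V \<tau>) \<le> N * exp (\<nu> * (t - \<tau>))"
    using assms(8) unfolding exp_dichotomy_def cU iU by blast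
  then interpret dichotomy A U V P N \<nu>
    by unfold_locales (use U V UV in auto)
  have green: "green A P = G" by (intro ext) (simp add: green_def G_def cU iU)
  \<comment> \<open>The perturbation has Lipschitz constant \<open>norm \<epsilon> * L\<close>; this
    is the threshold for \<open>\<kappa> * (norm \<epsilon> * L) \<le> 1/4\<close>.\<close>
  define \<epsilon>\<^sub>0 where "\<epsilon>\<^sub>0 = 1 / (4 * \<kappa> * L)"
  have \<epsilon>\<^sub>0: "\<epsilon>\<^sub>0 > 0" using \<kappa>_pos \<open>L > 0\<close> by (simp add: \<epsilon>\<^sub>0_def)
  have small: "norm \<epsilon> * L \<ge> 0" "\<kappa> * (norm \<epsilon> * L) \<le> 1/4" if "norm \<epsilon> \<le> \<epsilon>\<^sub>0" for \<epsilon> :: 'k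
    using that \<kappa>_pos \<open>L > 0\<close> by (auto simp: \<epsilon>\<^sub>0_def field_simps)
  have smulF: "norm (smul \<epsilon> (F (t, x)) - smul \<epsilon> (F (t, y))) \<le> norm \<epsilon> * L * norm (x - y)" for \<epsilon> t x y
    using mult_left_mono[OF assms(14)[of t x y] norm_ge_zero[of \<epsilon>]]
    by (simp add: smul.norm_smul mult.assoc flip: smul_lin.diff)
  have smulF0: "smul \<epsilon> (F (t, 0)) = 0" for \<epsilon> t
    by (simp add: assms(6) smul_lin.zero)
  have colour: "finite_colouring (\<lambda>h k. \<forall>t\<in>{-T..T}. \<forall>x\<in>K.
      dist (smul \<epsilon> (F (t + h, x))) (smul \<epsilon> (F (t + k, x))) < e)"
    if K: "compact K" and e: "e > 0" for K T \<epsilon> and e :: real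
  proof -
    \<comment> \<open>Dividing by \<open>norm \<epsilon> + 1\<close> also covers
      \<open>\<epsilon> = 0\<close>.\<close>
    have pos: "norm \<epsilon> + 1 > 0" using norm_ge_zero[of \<epsilon>] by linarith
    then have "e / (norm \<epsilon> + 1) > 0" using e by simp
    from lagrange_stable_imp_finite_colouring[OF assms(12) _ _ this, of "{-T..T} \<times> K"] K
    have col: "finite_colouring (\<lambda>h k. \<forall>p\<in>{-T..T} \<times> K.
        dist (shift2 h F p) (shift2 k F p) < e / (norm \<epsilon> + 1))"
      by (auto intro: compact_Times)
    show ?thesis
    proof (rule finite_colouring_mono[OF col], intro ballI)
      fix h k t x
      assume "\<forall>p\<in>{-T..T} \<times> K. dist (shift2 h F p) (shift2 k F p) < e / (norm \<epsilon> + 1)"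
        and "t \<in> {-T..T}" "x \<in> K"
      then have "dist (F (t + h, x)) (F (t + k, x)) < e / (norm \<epsilon> + 1)"
        by (force simp: shift2_def)
      then have "(norm \<epsilon> + 1) * norm (F (t + h, x) - F (t + k, x)) < e"
        using pos by (simp add: dist_norm pos_less_divide_eq mult.commute)
      moreover have "norm \<epsilon> * norm (F (t + h, x) - F (t + k, x))
          \<le> (norm \<epsilon> + 1) * norm (F (t + h, x) - F (t + k, x))"
        by (intro mult_right_mono) auto
      ultimately show "dist (smul \<epsilon> (F (t + h, x))) (smul \<epsilon> (F (t + k, x))) < e"
        by (simp add: dist_norm smul.norm_smul flip: smul_lin.diff)
    qed
  qed
  \<comment> \<open>The implication stands under the quantifier so that choice yields a function of
    all \<open>\<epsilon>\<close>, arbitrary beyond the threshold.\<close>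
  have "\<exists>\<phi>. norm \<epsilon> \<le> \<epsilon>\<^sub>0 \<longrightarrow> \<phi> \<in> bcontfun \<and> translation_precompact \<phi> \<and>
      (\<forall>t. (\<phi> has_vector_derivative A t (\<phi> t) + (f t + smul \<epsilon> (F (t, \<phi> t)))) (at t))" for \<epsilon>
  proof (cases "norm \<epsilon> \<le> \<epsilon>\<^sub>0")
    case True
    have cont: "continuous_on UNIV (\<lambda>p. smul \<epsilon> (F p))"
      by (rule bounded_linear.continuous_on[OF smul.bounded_linear_smul assms(5)])
    from semilinear_bounded_solution_exists[OF A assms(4) f cont smulF smulF0 small[OF True] colour]
    show ?thesis by blast
  qed auto
  then obtain \<phi> where \<phi>: "\<And>\<epsilon>. norm \<epsilon> \<le> \<epsilon>\<^sub>0 \<Longrightarrow> \<phi> \<epsilon> \<in> bcontfun"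
    "\<And>\<epsilon>. norm \<epsilon> \<le> \<epsilon>\<^sub>0 \<Longrightarrow> translation_precompact (\<phi> \<epsilon>)"
    "\<And>\<epsilon> t. norm \<epsilon> \<le> \<epsilon>\<^sub>0 \<Longrightarrow>
      (\<phi> \<epsilon> has_vector_derivative A t (\<phi> \<epsilon> t) + (f t + smul \<epsilon> (F (t, \<phi> \<epsilon> t)))) (at t)"
    by metis
  have rc: "remotely_compatible A f (\<lambda>p. smul \<epsilon> (F p)) (\<phi> \<epsilon>)" if "norm \<epsilon> \<le> \<epsilon>\<^sub>0" for \<epsilon>
    by (rule bounded_solution_remotely_compatible[OF \<phi>(3)[OF that] \<phi>(2)[OF that] M m smulF smulF0
          small[OF that]])
  have int: "((\<lambda>\<tau>. G t \<tau> (f \<tau> + smul \<epsilon> (F (\<tau>, \<phi> \<epsilon> \<tau>)))) has_integral \<phi> \<epsilon> t) UNIV"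
    if \<epsilon>: "norm \<epsilon> \<le> \<epsilon>\<^sub>0" for \<epsilon> t
  proof -
    obtain B where "\<And>t. norm (\<phi> \<epsilon> t) \<le> B"
      using translation_precompact_bounded[OF \<phi>(2)[OF \<epsilon>]] by blast
    then show ?thesis by (rule has_integral_green[OF \<phi>(3)[OF \<epsilon>]])
  qed
  have norm0: "norm (0 :: 'k) \<le> \<epsilon>\<^sub>0" using \<epsilon>\<^sub>0 by simp
  obtain B\<^sub>0 where B\<^sub>0: "\<And>t. norm (\<phi> 0 t) \<le> B\<^sub>0"
    using translation_precompact_bounded[OF \<phi>(2)[OF norm0]] by blast
  have B\<^sub>0_pos: "B\<^sub>0 \<ge> 0" using B\<^sub>0[of 0] norm_ge_zero[of "\<phi> 0 0"] by linarith
  \<comment> \<open>Bounding \<open>\<phi> \<epsilon>\<close> by \<open>\<phi> 0\<close> plus the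
    difference leaves only \<open>B\<^sub>0\<close>, independent of \<open>\<epsilon>\<close>, in
    the estimate; the bound \<open>B\<close>, which may vary with \<open>\<epsilon>\<close>, merely
    licenses the absorption.\<close>
  have close: "norm (\<phi> \<epsilon> t - \<phi> 0 t) \<le> 2 * \<kappa> * (norm \<epsilon> * L * B\<^sub>0)" if \<epsilon>: "norm \<epsilon> \<le> \<epsilon>\<^sub>0" for \<epsilon> t
  proof -
    obtain B where B: "\<And>t. norm (\<phi> \<epsilon> t) \<le> B"
      using translation_precompact_bounded[OF \<phi>(2)[OF \<epsilon>]] by blast
    let ?w = "\<lambda>t. \<phi> \<epsilon> t - \<phi> 0 t"
    have w: "(?w has_vector_derivative A s (?w s) + smul \<epsilon> (F (s, \<phi> \<epsilon> s))) (at s)" for s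
      using has_vector_derivative_diff[OF \<phi>(3)[OF \<epsilon>, of s] \<phi>(3)[OF norm0, of s]]
      by (simp add: blinfun.diff_right algebra_simps)
    have b: "norm (?w s) \<le> B + B\<^sub>0" for s
      by (rule order.trans[OF norm_triangle_ineq4 add_mono[OF B B\<^sub>0]])
    have g: "norm (smul \<epsilon> (F (s, \<phi> \<epsilon> s)))
        \<le> norm \<epsilon> * L * B\<^sub>0 * exp (\<nu> / 2 * \<bar>s - t\<bar>) + norm \<epsilon> * L * norm (?w s)" for s
    proof -
      have "norm (smul \<epsilon> (F (s, \<phi> \<epsilon> s))) \<le> norm \<epsilon> * L * norm (\<phi> \<epsilon> s)"
        using smulF[of \<epsilon> s "\<phi> \<epsilon> s" 0] by (simp add: smulF0)
      also have "\<dots> \<le> norm \<epsilon> * L * (B\<^sub>0 + norm (?w s))"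
        using small(1)[OF \<epsilon>] B\<^sub>0[of s] norm_triangle_ineq2[of "\<phi> \<epsilon> s" "\<phi> 0 s"]
        by (intro mult_left_mono) linarith+
      also have "\<dots> = norm \<epsilon> * L * B\<^sub>0 * 1 + norm \<epsilon> * L * norm (?w s)"
        by (simp add: distrib_left)
      also have "\<dots> \<le> norm \<epsilon> * L * B\<^sub>0 * exp (\<nu> / 2 * \<bar>s - t\<bar>) + norm \<epsilon> * L * norm (?w s)"
        using small(1)[OF \<epsilon>] B\<^sub>0_pos \<nu> by (intro add_mono mult_left_mono order_refl) auto
      finally show ?thesis .
    qed
    show ?thesis
      using perturbed_weighted_bound[OF w b _ small[OF \<epsilon>] g, of t] small(1)[OF \<epsilon>] B\<^sub>0_pos by simp
  qed
  have "uniform_limit UNIV \<phi> (\<phi> 0) (at 0)"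
  proof (rule uniform_limitI)
    fix e :: real assume e: "e > 0"
    have "((\<lambda>\<epsilon>::'k. 2 * \<kappa> * (norm \<epsilon> * L * B\<^sub>0)) \<longlongrightarrow> 2 * \<kappa> * (norm (0::'k) * L * B\<^sub>0)) (at 0)"
      by (intro tendsto_intros)
    then have "\<forall>\<^sub>F \<epsilon>::'k in at 0. 2 * \<kappa> * (norm \<epsilon> * L * B\<^sub>0) < e"
      using e by (intro order_tendstoD) auto
    moreover have "\<forall>\<^sub>F \<epsilon>::'k in at 0. norm \<epsilon> \<le> \<epsilon>\<^sub>0"
      unfolding eventually_at using \<epsilon>\<^sub>0 by (intro exI[of _ \<epsilon>\<^sub>0]) auto
    ultimately show "\<forall>\<^sub>F \<epsilon> in at 0. \<forall>t\<in>UNIV. dist (\<phi> \<epsilon> t) (\<phi> 0 t) < e"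
    proof eventually_elim
      case (elim \<epsilon>)
      then show ?case using close[OF elim(2)] by (auto simp: dist_norm intro: order.strict_trans1)
    qed
  qed
  moreover have "smul 0 (F p) = 0" for p by simp
  ultimately show ?thesis
    using \<epsilon>\<^sub>0 \<phi>(1) rc int rc[OF norm0] int[OF norm0] unfolding green
    by (intro exI[of _ \<epsilon>\<^sub>0] exI[of _ \<phi>] conjI allI impI) simp_all
qed

end
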